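(* For every bounded subset $B$ of $X_1$ there exist constants $C>0$ and $K>0$ such that for all $t\in[0,1]$, all $\lambda\in\mathbb{C}$ with $|\lambda|>K$ and all $\psi\in B$, $$|\lambda|\, e^{-2|\operatorname{Im}(\lambda^2)|t}\,\big|M(t,\lambda,\psi)-E_\lambda(t)\big|\le C .$$ Moreover, the $\lambda$-derivative $\dot M=\partial_\lambda M$ satisfies $\dot M(t,\lambda,\psi)=\dot E_\lambda(t)+\mathcal{O}\big(e^{2|\operatorname{Im}(\lambda^2)|t}\big)$ as $|\lambda|\to\infty$, uniformly for $t\in[0,1]$ and $\psi$ in bounded subsets of $X_1$; that is, for every bounded $B\subset X_1$ there exist $C',K'>0$ such that $|\dot M(t,\lambda,\psi)-\dot E_\lambda(t)|\le C' e^{2|\operatorname{Im}(\lambda^2)|t}$ for all $t\in[0,1]$, $|\lambda|>K'$, $\psi\in B$.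
   Context: $X_1=H^1([0,1],\mathbb{C})^4$ with its Hilbert norm ($\|\psi\|^2=\sum_{j=1}^4\int_0^1(|\psi^j|^2+|\psi^j_t|^2)\,dt$); elements are written $\psi=(\psi^1,\psi^2,\psi^3,\psi^4)$. Let $\sigma_3=\mathrm{diag}(1,-1)$ and $$V(t,\lambda,\psi)=\begin{pmatrix}-i\psi^1\psi^2 & 2\lambda\psi^1+i\psi^3\\ 2\lambda\psi^2-i\psi^4 & i\psi^1\psi^2\end{pmatrix}(t).$$ For $\lambda\in\mathbb{C}$ and $\psi\in X_1$, $M(t,\lambda,\psi)$ denotes the unique $2\times2$ matrix solution on $[0,1]$ of $\partial_tM=(-2i\lambda^2\sigma_3+V)M$, $M(0,\lambda,\psi)=I$ (it is analytic in $\lambda$). $E_\lambda(t)=e^{-2i\lambda^2t\sigma_3}$ is the solution for $\psi=0$. A dot denotes $\partial/\partial\lambda$, and $|\cdot|$ on matrices is the operator norm induced by the Euclidean norm of $\mathbb{C}^2$. *)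

theory Defs
  imports "HOL-Analysis.Analysis"
begin

text \<open>The Sobolev space $H^1([0,1],C)$, with weak derivatives tested against $C^1$ functions with
  compact support in the open interval. Since $H^1$ functions are evaluated pointwise below, a
  class is represented by its continuous representative; values outside $[0,1]$ are irrelevant.\<close>

definition test_function :: "(real \<Rightarrow> real) \<Rightarrow> bool" where
  "test_function \<phi> \<longleftrightarrow> \<phi> C1_differentiable_on UNIV \<and> closure {t. \<phi> t \<noteq> 0} \<subseteq> {0<..<1}"

definition square_integrable :: "(real \<Rightarrow> complex) \<Rightarrow> bool" where
  "square_integrable g \<longleftrightarrow> set_borel_measurable lborel {0..1} g \<and>
     set_integrable lborel {0..1} (\<lambda>t. (cmod (g t))\<^sup>2)"

definition is_weak_deriv :: "(real \<Rightarrow> complex) \<Rightarrow> (real \<Rightarrow> complex) \<Rightarrow> bool" where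
  "is_weak_deriv f g \<longleftrightarrow> (\<forall>\<phi>. test_function \<phi> \<longrightarrow>
     (LINT t:{0..1}|lborel. f t * of_real (deriv \<phi> t)) =
     - (LINT t:{0..1}|lborel. g t * of_real (\<phi> t)))"

definition H1 :: "(real \<Rightarrow> complex) set" where
  "H1 = {f. continuous_on {0..1} f \<and> (\<exists>g. square_integrable g \<and> is_weak_deriv f g)}"

text \<open>Unique up to null sets, which is all that the norm below depends on.\<close>

definition weak_deriv :: "(real \<Rightarrow> complex) \<Rightarrow> real \<Rightarrow> complex" where
  "weak_deriv f = (SOME g. square_integrable g \<and> is_weak_deriv f g)"

definition X1 :: "((real \<Rightarrow> complex)^4) set" where
  "X1 = {\<psi>. \<forall>j. \<psi> $ j \<in> H1}"

definition X1_norm :: "(real \<Rightarrow> complex)^4 \<Rightarrow> real" where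
  "X1_norm \<psi> = sqrt (\<Sum>j\<in>UNIV.
     LINT t:{0..1}|lborel. (cmod ((\<psi> $ j) t))\<^sup>2 + (cmod (weak_deriv (\<psi> $ j) t))\<^sup>2)"

definition X1_bounded :: "((real \<Rightarrow> complex)^4) set \<Rightarrow> bool" where
  "X1_bounded B \<longleftrightarrow> B \<subseteq> X1 \<and> (\<exists>R. \<forall>\<psi>\<in>B. X1_norm \<psi> \<le> R)"

definition sigma3 :: "complex^2^2" where
  "sigma3 = vector [vector [1, 0], vector [0, -1]]"

definition V :: "real \<Rightarrow> complex \<Rightarrow> (real \<Rightarrow> complex)^4 \<Rightarrow> complex^2^2" where
  "V t l \<psi> = vector
     [vector [- \<i> * (\<psi> $ 1) t * (\<psi> $ 2) t, 2 * l * (\<psi> $ 1) t + \<i> * (\<psi> $ 3) t],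
      vector [2 * l * (\<psi> $ 2) t - \<i> * (\<psi> $ 4) t, \<i> * (\<psi> $ 1) t * (\<psi> $ 2) t]]"

text \<open>Here \<^term>\<open>mat c ** A\<close> is the scalar multiple $cA$.\<close>

definition is_fundamental_solution ::
    "complex \<Rightarrow> (real \<Rightarrow> complex)^4 \<Rightarrow> (real \<Rightarrow> complex^2^2) \<Rightarrow> bool" where
  "is_fundamental_solution l \<psi> F \<longleftrightarrow> F 0 = mat 1 \<and>
     (\<forall>t\<in>{0..1}. (F has_vector_derivative
        (mat (- 2 * \<i> * l\<^sup>2) ** sigma3 + V t l \<psi>) ** F t) (at t within {0..1}))"

text \<open>The choice matters only outside $[0,1]$, where the solution is not determined.\<close>

definition M :: "real \<Rightarrow> complex \<Rightarrow> (real \<Rightarrow> complex)^4 \<Rightarrow> complex^2^2" where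
  "M t l \<psi> = (SOME F. is_fundamental_solution l \<psi> F) t"

text \<open>The matrix exponential of the diagonal matrix $-2i l^2 t \sigma_3$.\<close>

definition E :: "complex \<Rightarrow> real \<Rightarrow> complex^2^2" where
  "E l t = vector [vector [exp (- 2 * \<i> * l\<^sup>2 * of_real t), 0],
                   vector [0, exp (2 * \<i> * l\<^sup>2 * of_real t)]]"

definition matrix_deriv :: "(complex \<Rightarrow> complex^2^2) \<Rightarrow> complex \<Rightarrow> complex^2^2" where
  "matrix_deriv A l = (\<chi> i j. deriv (\<lambda>z. A z $ i $ j) l)"

definition op_norm :: "complex^2^2 \<Rightarrow> real" where
  "op_norm A = onorm (\<lambda>x. A *v x)"

end

theory Submission
  imports Defs "HOL-Complex_Analysis.Cauchy_Integral_Formula"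
begin

text \<open>Write a column of $M$ as $(u,v)$, $\sigma = 2|\mathrm{Im}(\lambda^2)|$. Its equations
  $u' = (-2i\lambda^2 - i\psi^1\psi^2) u + (2\lambda\psi^1 + i\psi^3) v$ and
  $v' = (2\lambda\psi^2 - i\psi^4) u + (2i\lambda^2 + i\psi^1\psi^2) v$ are coupled by terms of size
  $|\lambda|$, so perturbing directly around $E_\lambda$ fails. The coupling is however fast
  oscillating and can be removed by a change of unknowns close to the identity,
  $n_1 = u + qv$, $n_2 = v + ku$ with $q = i\psi^1/(2\lambda) - \psi^3/(4\lambda^2)$ and a similar
  $k$. This choice cancels all terms of order $\lambda$ and of order $1$; the diagonal
  entry $-i\psi^1\psi^2$ of $V$ is to leading order what the term $2\lambda\psi^2 q$ produces with the
  opposite sign. What remains is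
  $n_1' = -2i\lambda^2 n_1 + O(1/|\lambda|)(|u|+|v|)$, and likewise for $n_2$, where the error is measured in
  $L^1$ because it contains $q'$. Variation of constants bounds $n_1 - e^{-2i\lambda^2t} n_1(0)$ by
  $O(W/|\lambda|) e^{\sigma t}$ with $W = \sup_t e^{-\sigma t}(|u|+|v|)$
  (\<open>gauged_component_estimate\<close>). Since $q, k = O(1/|\lambda|)$, this in turn bounds $W$ for large
  $|\lambda|$, and the first claim follows (\<open>solution_asymptotics\<close>).

  The components of $\psi$ are only in $H^1$, so $q$ is not differentiable pointwise. In $q$ each
  $\psi^j$ is therefore replaced by a $C^1$ function $p$ with $|p - \psi^j| \le |\lambda|^{-2}$ and
  $\int |p'|$ bounded in terms of the norm of $\psi$ (\<open>smooth_approximation\<close>). Even after multiplication by the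
  factor $2\lambda$ the replacement costs only $O(1/|\lambda|)$. The only fact about weak derivatives
  behind this is $|f(b) - f(a)| \le \int_a^b |f'|$ (\<open>weak_deriv_increment\<close>).

  For the second claim, $M$ is entire in $\lambda$, being the locally uniform limit of Picard sums that are
  polynomials in $\lambda$ (\<open>linear_solution_exists_holomorphic\<close>). Cauchy's inequality on the circle of
  radius $1/|\lambda|$ around $\lambda$ costs a factor $|\lambda|$, which the first claim pays for; and
  $z^2$ stays within distance $3$ of $\lambda^2$ on this circle, so that the exponential weight changes
  by a constant factor only (\<open>derivative_entry_asymptotics\<close>).\<close>

section \<open>Increments of functions with a weak derivative\<close>

text \<open>A piecewise quadratic step from $0$ to $1$ across $[0,1]$. It is $C^1$, and its derivative \<open>hat\<close> is a
  tent of area $1$ over $[0,1]$. Differences of its rescalings are test functions approximating the indicator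
  function of an interval.\<close>

definition ramp :: "real \<Rightarrow> real" where
  "ramp x = 2 * ((max 0 x)\<^sup>2 - 2 * (max 0 (x - 1/2))\<^sup>2 + (max 0 (x - 1))\<^sup>2)"

definition hat :: "real \<Rightarrow> real" where
  "hat x = 4 * (max 0 x - 2 * max 0 (x - 1/2) + max 0 (x - 1))"

lemma pos_part_square_deriv: "((\<lambda>x::real. (max 0 x)\<^sup>2) has_real_derivative 2 * max 0 x) (at x)"
proof (cases "x = 0")
  case True
  have "(max 0 z)\<^sup>2 - (max 0 x)\<^sup>2 = max 0 z * (z - x)" for z
    using True by (simp add: max_def power2_eq_square)
  moreover have "isCont (\<lambda>z::real. max 0 z) x" by (intro continuous_intros)
  ultimately have "\<exists>g. (\<forall>z. (max 0 z)\<^sup>2 - (max 0 x)\<^sup>2 = g z * (z - x)) \<and> isCont g x \<and> g x = 2 * max 0 x"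
    using True by (intro exI[of _ "\<lambda>z. max 0 z"]) simp
  then show ?thesis unfolding CARAT_DERIV .
next
  case False
  show ?thesis
  proof (cases "x < 0")
    case True
    have "((\<lambda>_. 0) has_real_derivative 0) (at x)" by simp
    then have "((\<lambda>x::real. (max 0 x)\<^sup>2) has_real_derivative 0) (at x)"
      by (rule has_field_derivative_transform_within_open[of _ _ _ "{..<0}"])
         (use True in \<open>simp_all add: max_absorb1\<close>)
    then show ?thesis using True by (simp add: max_absorb1)
  next
    case nonneg: False
    have "((\<lambda>x. x\<^sup>2) has_real_derivative 2 * x) (at x)"
      using DERIV_power[OF DERIV_ident, of 2] by simp
    then have "((\<lambda>x::real. (max 0 x)\<^sup>2) has_real_derivative 2 * x) (at x)"
      by (rule has_field_derivative_transform_within_open[of _ _ _ "{0<..}"])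
         (use nonneg False in \<open>simp_all add: max_absorb2\<close>)
    then show ?thesis using nonneg by (simp add: max_absorb2)
  qed
qed

lemma ramp_deriv: "(ramp has_real_derivative hat x) (at x)"
proof -
  have shift: "((\<lambda>x. (max 0 (x - c))\<^sup>2) has_real_derivative 2 * max 0 (x - c)) (at x)" for c
    using DERIV_shift[of "\<lambda>x. (max 0 x)\<^sup>2" "2 * max 0 (x - c)" x "- c"] pos_part_square_deriv[of "x - c"]
    by simp
  have "((\<lambda>x. 2 * ((max 0 x)\<^sup>2 - 2 * (max 0 (x - 1/2))\<^sup>2 + (max 0 (x - 1))\<^sup>2)) has_real_derivative
      2 * (2 * max 0 x - 2 * (2 * max 0 (x - 1/2)) + 2 * max 0 (x - 1))) (at x)"
    by (intro DERIV_cmult DERIV_add DERIV_diff shift pos_part_square_deriv)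
  then show ?thesis unfolding ramp_def[abs_def] hat_def by (simp add: algebra_simps)
qed

lemma hat_nonneg: "0 \<le> hat x" and hat_outside: "x \<le> 0 \<or> 1 \<le> x \<Longrightarrow> hat x = 0"
  by (auto simp: hat_def max_def)

lemma ramp_left: "x \<le> 0 \<Longrightarrow> ramp x = 0"
  by (simp add: ramp_def max_absorb1)

lemma ramp_right: "1 \<le> x \<Longrightarrow> ramp x = 1"
  by (simp add: ramp_def max_absorb2) (simp add: power2_eq_square field_simps)

lemma ramp_mono: "x \<le> y \<Longrightarrow> ramp x \<le> ramp y"
proof (rule DERIV_nonneg_imp_nondecreasing[where f=ramp])
  show "\<exists>y. (ramp has_real_derivative y) (at t) \<and> 0 \<le> y" for t
    by (intro exI[of _ "hat t"] conjI ramp_deriv hat_nonneg)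
qed

lemma ramp_range: "ramp x \<in> {0..1}"
  using ramp_mono[of x "max 1 x"] ramp_mono[of "min 0 x" x]
    ramp_right[of "max 1 x"] ramp_left[of "min 0 x"] by simp

lemma scaled_ramp_left: "e > 0 \<Longrightarrow> t \<le> a \<Longrightarrow> ramp ((t - a) / e) = 0"
  by (simp add: ramp_left divide_nonpos_pos)

lemma scaled_ramp_right: "e > 0 \<Longrightarrow> a + e \<le> t \<Longrightarrow> ramp ((t - a) / e) = 1"
  by (simp add: ramp_right)

lemma scaled_ramp_deriv:
  "((\<lambda>t. ramp ((t - a) / e)) has_real_derivative hat ((t - a) / e) / e) (at t)"
proof -
  have "((\<lambda>t. (t - a) / e) has_real_derivative (1 - 0) / e) (at t)"
    by (intro DERIV_cdivide DERIV_diff DERIV_ident DERIV_const)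
  from DERIV_chain2[OF ramp_deriv this] show ?thesis by simp
qed

lemma continuous_hat: "continuous_on S (\<lambda>t. hat ((t - a) / e) / e)"
  unfolding hat_def divide_inverse by (intro continuous_intros)

text \<open>The rescaled tent is a probability density supported in $[a,a+e]$, hence averaging against it moves
  no further from $c$ than the values of $f$ on that interval do.\<close>

lemma hat_average_close:
  assumes f: "continuous_on {0..1} f" and e: "0 < e" "0 \<le> a" "a + e \<le> 1"
    and close: "\<And>t. t \<in> {a..a + e} \<Longrightarrow> cmod (f t - c) \<le> \<eta>"
  shows "cmod (integral {0..1} (\<lambda>t. f t * of_real (hat ((t - a) / e) / e)) - c) \<le> \<eta>"
proof -
  let ?k = "\<lambda>t. hat ((t - a) / e) / e"
  have one: "(?k has_integral 1) {0..1}"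
  proof -
    have "(?k has_integral ramp ((1 - a) / e) - ramp ((0 - a) / e)) {0..1}"
    proof (rule fundamental_theorem_of_calculus)
      show "((\<lambda>t. ramp ((t - a) / e)) has_vector_derivative ?k t) (at t within {0..1})" for t
        using has_field_derivative_at_within[OF scaled_ramp_deriv]
        unfolding has_real_derivative_iff_has_vector_derivative .
    qed simp
    moreover have "ramp ((1 - a) / e) = 1" "ramp ((0 - a) / e) = 0"
      using e by (auto intro!: ramp_right ramp_left simp: field_simps)
    ultimately show ?thesis by simp
  qed
  have oneC: "((\<lambda>t. complex_of_real (?k t)) has_integral 1) {0..1}"
    by (rule has_integral_of_real[OF one, unfolded of_real_1])
  have fk: "(\<lambda>t. f t * of_real (?k t)) integrable_on {0..1}"
    by (intro integrable_continuous_interval continuous_intros f continuous_hat)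
  have "((\<lambda>t. f t * of_real (?k t) - c * of_real (?k t)) has_integral
         (integral {0..1} (\<lambda>t. f t * of_real (?k t)) - c * 1)) {0..1}"
    by (intro has_integral_diff has_integral_mult_right oneC integrable_integral fk)
  then have eq: "integral {0..1} (\<lambda>t. f t * of_real (?k t)) - c =
         integral {0..1} (\<lambda>t. (f t - c) * of_real (?k t))"
    unfolding left_diff_distrib by (simp only: integral_unique mult_1_right)
  have "cmod (integral {0..1} (\<lambda>t. (f t - c) * of_real (?k t))) \<le> integral {0..1} (\<lambda>t. \<eta> * ?k t)"
  proof (rule integral_norm_bound_integral)
    show "(\<lambda>t. (f t - c) * of_real (?k t)) integrable_on {0..1}"
      by (intro integrable_continuous_interval continuous_intros f continuous_hat)
    show "(\<lambda>t. \<eta> * ?k t) integrable_on {0..1}" 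
      using has_integral_mult_right[OF one] by blast
    fix t :: real assume "t \<in> {0..1}"
    show "cmod ((f t - c) * of_real (?k t)) \<le> \<eta> * ?k t"
    proof (cases "t \<in> {a..a+e}")
      case True
      have k: "0 \<le> ?k t" using hat_nonneg e(1) by simp
      show ?thesis unfolding norm_mult norm_of_real abs_of_nonneg[OF k]
        by (rule mult_right_mono[OF close[OF True] k])
    next
      case False
      then have "hat ((t - a) / e) = 0" using e(1) by (intro hat_outside) (auto simp: field_simps)
      then show ?thesis by simp
    qed
  qed
  also have "\<dots> = \<eta>" using integral_unique[OF has_integral_mult_right[OF one, of \<eta>]] by simp
  finally show ?thesis unfolding eq .
qed

lemma square_integrable_imp_integrable:
  assumes "square_integrable g"
  shows "set_integrable lborel {0..1} g" "set_integrable lborel {0..1} (\<lambda>t. cmod (g t))"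
    "integral {0..1} (\<lambda>t. cmod (g t)) \<le> 1 + (LINT t:{0..1}|lborel. (cmod (g t))\<^sup>2)"
proof -
  have m: "set_borel_measurable lborel {0..1} g" 
    and i2: "set_integrable lborel {0..1} (\<lambda>t. (cmod (g t))\<^sup>2)"
    using assms by (auto simp: square_integrable_def)
  have i1: "set_integrable lborel {0..1} (\<lambda>t::real. 1::real)"
    by (intro borel_integrable_atLeastAtMost' continuous_intros)
  have i12: "set_integrable lborel {0..1} (\<lambda>t. 1 + (cmod (g t))\<^sup>2)"
    by (intro set_integral_add i1 i2)
  have le: "x \<le> 1 + x\<^sup>2" for x :: real
    using zero_le_power2[of "x - 1/2"] by (simp add: power2_eq_square algebra_simps)
  show 1: "set_integrable lborel {0..1} g"
  proof (rule set_integrable_bound[OF i12 m], intro AE_I2 impI)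
    show "cmod (g t) \<le> norm (1 + (cmod (g t))\<^sup>2)" for t using le[of "cmod (g t)"] by simp
  qed
  show 2: "set_integrable lborel {0..1} (\<lambda>t. cmod (g t))"
    using set_integrable_norm[OF 1] .
  have "integral {0..1} (\<lambda>t. cmod (g t)) \<le> integral {0..1} (\<lambda>t. 1 + (cmod (g t))\<^sup>2)"
    by (intro integral_le set_borel_integral_eq_integral(1)[OF 2] set_borel_integral_eq_integral(1)[OF i12] le)
  also have "\<dots> = 1 + (LINT t:{0..1}|lborel. (cmod (g t))\<^sup>2)"
    using set_borel_integral_eq_integral[OF i2] set_borel_integral_eq_integral(1)[OF i1]
    by (simp add: Henstock_Kurzweil_Integration.integral_add)
  finally show "integral {0..1} (\<lambda>t. cmod (g t)) \<le> 1 + (LINT t:{0..1}|lborel. (cmod (g t))\<^sup>2)" .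
qed

lemma test_function_ramp_diff:
  assumes "0 < a" "a \<le> b" "0 < e" "b + e < 1"
  shows "test_function (\<lambda>t. ramp ((t - a) / e) - ramp ((t - b) / e))"
    (is "test_function ?\<phi>")
    and "deriv (\<lambda>t. ramp ((t - a) / e) - ramp ((t - b) / e)) = 
         (\<lambda>t. hat ((t - a) / e) / e - hat ((t - b) / e) / e)" (is "_ = ?\<phi>'")
proof -
  have d: "(?\<phi> has_real_derivative ?\<phi>' t) (at t)" for t
    by (intro DERIV_diff scaled_ramp_deriv)
  then show "deriv ?\<phi> = ?\<phi>'" by (intro ext DERIV_imp_deriv)
  have "{t. ?\<phi> t \<noteq> 0} \<subseteq> {a..b + e}"
  proof
    fix t assume "t \<in> {t. ?\<phi> t \<noteq> 0}"
    then show "t \<in> {a..b + e}"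
      using assms by (cases "t < a"; cases "b + e < t") (auto simp: scaled_ramp_left scaled_ramp_right)
  qed
  then have "closure {t. ?\<phi> t \<noteq> 0} \<subseteq> {a..b + e}" by (rule closure_minimal) auto
  moreover have "?\<phi> C1_differentiable_on UNIV" unfolding C1_differentiable_on_def
    by (intro exI[of _ ?\<phi>'] conjI ballI continuous_on_diff continuous_hat)
       (rule d[unfolded has_real_derivative_iff_has_vector_derivative])
  ultimately show "test_function ?\<phi>" unfolding test_function_def using assms by auto
qed

text \<open>Tested against the difference of two narrow ramps starting at $a$ and at $b$, the weak derivative
  identity has on its left the difference of two averages of $f$, which tend to $f(a)$ and $f(b)$
  as the width shrinks, and on its right an integral of $g$ with weight in $[0,1]$ supported
  in $[a,b+e]$.\<close>

lemma weak_deriv_increment: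
  assumes f: "continuous_on {0..1} f" and g: "square_integrable g" and w: "is_weak_deriv f g"
    and ab: "0 \<le> a" "a \<le> b" "b \<le> 1"
  shows "cmod (f b - f a) \<le> integral {0..b} (\<lambda>t. cmod (g t)) - integral {0..a} (\<lambda>t. cmod (g t))"
proof -
  define v where "v = (\<lambda>x. integral {0..x} (\<lambda>t. cmod (g t)))"
  note gi = square_integrable_imp_integrable[OF g]
  have ig: "(\<lambda>t. cmod (g t)) integrable_on {0..1}" by (rule set_borel_integral_eq_integral(1)[OF gi(2)])
  have cv: "continuous_on {0..1} v" unfolding v_def by (rule indefinite_integral_continuous_1[OF ig])
  have vdiff: "v y - v x = integral {x..y} (\<lambda>t. cmod (g t))" if "0 \<le> x" "x \<le> y" "y \<le> 1" for x y
    using Henstock_Kurzweil_Integration.integral_combine[of 0 x y "\<lambda>t. cmod (g t)"] that 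
      integrable_subinterval_real[OF ig, of 0 y] by (auto simp: v_def)
  have key: "cmod (f b - f a) \<le> v (b + e) - v a + 2 * \<eta>" 
    if "0 < a" "a \<le> b" "0 < e" "b + e < 1"
      "\<And>t. t \<in> {a..a + e} \<Longrightarrow> cmod (f t - f a) \<le> \<eta>"
      "\<And>t. t \<in> {b..b + e} \<Longrightarrow> cmod (f t - f b) \<le> \<eta>" for a b e \<eta>
  proof -
    let ?\<phi> = "\<lambda>t. ramp ((t - a) / e) - ramp ((t - b) / e)"
    let ?I = "\<lambda>c. integral {0..1} (\<lambda>t. f t * of_real (hat ((t - c) / e) / e))"
    have cf: "continuous_on {0..1} (\<lambda>t. f t * of_real (hat ((t - c) / e) / e))" for c
      by (intro continuous_intros f continuous_hat)
    have "(LINT t:{0..1}|lborel. f t * of_real (deriv ?\<phi> t)) = ?I a - ?I b"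
    proof -
      have "(LINT t:{0..1}|lborel. f t * of_real (deriv ?\<phi> t)) = 
            integral {0..1} (\<lambda>t. f t * of_real (hat ((t - a) / e) / e - hat ((t - b) / e) / e))"
        unfolding test_function_ramp_diff(2)[OF that(1-4)]
        by (intro set_borel_integral_eq_integral borel_integrable_atLeastAtMost' continuous_intros f continuous_hat)
      also have "\<dots> = integral {0..1} (\<lambda>t. f t * of_real (hat ((t - a) / e) / e) - f t * of_real (hat ((t - b) / e) / e))"
        by (simp add: right_diff_distrib)
      also have "\<dots> = ?I a - ?I b"
        by (intro Henstock_Kurzweil_Integration.integral_diff integrable_continuous_interval cf)
      finally show ?thesis .
    qed
    then have eq: "?I a - ?I b = - (LINT t:{0..1}|lborel. g t * of_real (?\<phi> t))"
      using w test_function_ramp_diff(1)[OF that(1-4)] unfolding is_weak_deriv_def by simp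
    have \<phi>01: "\<bar>?\<phi> t\<bar> \<le> 1" for t
      using ramp_range[of "(t - a) / e"] ramp_range[of "(t - b) / e"] by (auto simp: abs_le_iff)
    have \<phi>0: "?\<phi> t = 0" if "t \<notin> {a..b + e}" for t
      using that \<open>a \<le> b\<close> \<open>0 < e\<close> 
      by (cases "t < a"; cases "b + e < t") (auto simp: scaled_ramp_left scaled_ramp_right)
    have c\<phi>: "continuous_on UNIV ?\<phi>" 
      using DERIV_isCont[OF scaled_ramp_deriv]
      by (intro continuous_at_imp_continuous_on ballI continuous_diff) auto
    have bound: "cmod (g t * of_real (?\<phi> t)) \<le> (if t \<in> {a..b+e} then cmod (g t) else 0)" for t
    proof (cases "t \<in> {a..b + e}")
      case True
      then show ?thesis using mult_left_le[OF \<phi>01[of t], of "cmod (g t)"] by (simp only: norm_mult norm_of_real if_True norm_ge_zero)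
    next
      case False
      then show ?thesis using \<phi>0[OF False] by (simp only: if_False) simp
    qed
    have ig\<phi>: "set_integrable lborel {0..1} (\<lambda>t. g t * of_real (?\<phi> t))"
    proof (rule set_integrable_bound[OF gi(1)])
      have "(\<lambda>t. indicator {0..1} t *\<^sub>R g t) \<in> borel_measurable lborel" 
        using g by (simp add: square_integrable_def set_borel_measurable_def)
      moreover have "(\<lambda>t. complex_of_real (?\<phi> t)) \<in> borel_measurable lborel"
        using borel_measurable_continuous_onI[OF continuous_on_of_real[OF c\<phi>]] by simp
      ultimately have "(\<lambda>t. (indicator {0..1} t *\<^sub>R g t) * of_real (?\<phi> t)) \<in> borel_measurable lborel"
        by (rule borel_measurable_times)
      then show "set_borel_measurable lborel {0..1} (\<lambda>t. g t * of_real (?\<phi> t))"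
        unfolding set_borel_measurable_def mult_scaleR_left .
      show "AE t in lborel. t \<in> {0..1} \<longrightarrow> cmod (g t * of_real (?\<phi> t)) \<le> cmod (g t)"
        using mult_left_le[OF \<phi>01] by (intro AE_I2 impI) (simp only: norm_mult norm_of_real norm_ge_zero)
    qed
    have "cmod (integral {0..1} (\<lambda>t. g t * of_real (?\<phi> t))) 
          \<le> integral {0..1} (\<lambda>t. if t \<in> {a..b+e} then cmod (g t) else 0)"
    proof (rule integral_norm_bound_integral[OF set_borel_integral_eq_integral(1)[OF ig\<phi>] _ bound])
      show "(\<lambda>t. if t \<in> {a..b+e} then cmod (g t) else 0) integrable_on {0..1}"
        unfolding integrable_restrict_Int using that
        by (auto intro!: integrable_subinterval_real[OF ig] simp: Int_absorb2)
    qed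
    also have "\<dots> = integral {a..b+e} (\<lambda>t. cmod (g t))"
      unfolding integral_restrict_Int using that by (auto simp: Int_absorb2)
    also have "\<dots> = v (b + e) - v a" using vdiff[of a "b + e"] that by auto
    finally have "cmod (?I a - ?I b) \<le> v (b + e) - v a"
      unfolding eq set_borel_integral_eq_integral(2)[OF ig\<phi>] by simp
    moreover have "cmod (?I a - f a) \<le> \<eta>"
      by (rule hat_average_close[OF f that(3) _ _ that(5)]) (use that in simp_all)
    moreover have "cmod (?I b - f b) \<le> \<eta>"
      by (rule hat_average_close[OF f that(3) _ _ that(6)]) (use that in simp_all)
    ultimately show ?thesis
      using norm_triangle_ineq4[of "?I a - f a" "?I b - f b"] 
        norm_triangle_ineq4[of "(?I a - f a) - (?I b - f b)" "?I a - ?I b"]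
      by (simp add: algebra_simps)
  qed
  have interior: "cmod (f b - f a) \<le> v b - v a" if ab: "0 < a" "a \<le> b" "b < 1" for a b
  proof (rule field_le_epsilon)
    fix \<eta> :: real assume "\<eta> > 0"
    have right: "\<exists>d>0. \<forall>t\<in>{c..c + d}. dist (h t) (h c) < \<eta> / 3" 
      if "continuous_on {0..1} h" "0 < c" "c < 1" for h :: "real \<Rightarrow> 'b::metric_space" and c
    proof -
      have "\<exists>d>0. \<forall>t\<in>{0..1}. dist t c < d \<longrightarrow> dist (h t) (h c) < \<eta> / 3"
        using that \<open>\<eta> > 0\<close> unfolding continuous_on_iff by (metis atLeastAtMost_iff divide_pos_pos less_imp_le zero_less_numeral)
      then obtain d where "d > 0" and d: "\<forall>t\<in>{0..1}. dist t c < d \<longrightarrow> dist (h t) (h c) < \<eta> / 3" by blast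
      then show ?thesis using that
        by (intro exI[of _ "min (d / 2) (1 - c)"]) (auto simp: dist_real_def)
    qed
    obtain d1 where d1: "d1 > 0" "\<And>t. t \<in> {a..a + d1} \<Longrightarrow> dist (f t) (f a) < \<eta> / 3"
      using right[OF f, of a] ab by auto
    obtain d2 where d2: "d2 > 0" "\<And>t. t \<in> {b..b + d2} \<Longrightarrow> dist (f t) (f b) < \<eta> / 3"
      using right[OF f, of b] ab by auto
    obtain d3 where d3: "d3 > 0" "\<And>t. t \<in> {b..b + d3} \<Longrightarrow> dist (v t) (v b) < \<eta> / 3"
      using right[OF cv, of b] ab by auto
    define e where "e = min (min d1 d2) (min d3 ((1 - b) / 2))"
    have e: "e > 0" "e \<le> d1" "e \<le> d2" "e \<le> d3" "b + e < 1"
      using d1 d2 d3 ab by (auto simp: e_def min_def field_simps)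
    have "cmod (f b - f a) \<le> v (b + e) - v a + 2 * (\<eta> / 3)"
      using d1(2) d2(2) e ab by (intro key) (force simp: dist_norm)+
    moreover have "\<bar>v (b + e) - v b\<bar> < \<eta> / 3" 
      unfolding dist_real_def[symmetric] by (rule d3(2)) (use e in auto)
    ultimately show "cmod (f b - f a) \<le> v b - v a + \<eta>" by linarith
  qed
  \<comment> \<open>The points $0$ and $1$ are reached by contracting the pair towards the midpoint.\<close>
  define c where "c = (\<lambda>x s. x + s * (1/2 - x) :: real)"
  have c01: "c x s \<in> {0..1}" if "x \<in> {0..1}" "s \<in> {0..1}" for x s
    using that convexD_alt[OF convex_real_interval(5)[of 0 1], of x "1/2" s] 
    by (simp add: c_def algebra_simps)
  have "0 \<le> v (c b 0) - v (c a 0) - cmod (f (c b 0) - f (c a 0))"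
  proof (rule continuous_ge_on_closure[of "{0<..<1}" "\<lambda>s. v (c b s) - v (c a s) - cmod (f (c b s) - f (c a s))"])
    have "continuous_on {0..1} (\<lambda>s. c x s)" for x unfolding c_def by (intro continuous_intros)
    then show "continuous_on (closure {0<..<1}) (\<lambda>s. v (c b s) - v (c a s) - cmod (f (c b s) - f (c a s)))"
      using c01 ab by (auto intro!: continuous_intros continuous_on_compose2[OF cv] continuous_on_compose2[OF f])
    fix s :: real assume s: "s \<in> {0<..<1}"
    have "0 < c x s \<and> c x s < 1" if "0 \<le> x" "x \<le> 1" for x
    proof -
      have "c x s = (1 - s) * x + s / 2" by (simp add: c_def algebra_simps)
      moreover have "0 \<le> (1 - s) * x" using s that by simp
      moreover have "(1 - s) * x \<le> 1 - s" by (rule mult_left_le) (use s that in auto)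
      ultimately show ?thesis using s unfolding greaterThanLessThan_iff by linarith
    qed
    moreover have "c a s \<le> c b s" 
      using s ab mult_left_mono[of a b "1 - s"] by (simp add: c_def algebra_simps)
    ultimately show "0 \<le> v (c b s) - v (c a s) - cmod (f (c b s) - f (c a s))"
      using interior[of "c a s" "c b s"] ab by auto
  qed auto
  then show ?thesis by (simp add: c_def v_def)
qed

text \<open>The primitive of $|f'|$ is such a $v$. A bound on increments passes directly to the derivative of a
  moving average, which is an increment divided by the averaging length.\<close>

definition variation_majorant :: "(real \<Rightarrow> complex) \<Rightarrow> (real \<Rightarrow> real) \<Rightarrow> bool" where
  "variation_majorant f v \<longleftrightarrow> continuous_on {0..1} v \<and> v 0 = 0 \<and>
     (\<forall>a\<in>{0..1}. \<forall>b\<in>{0..1}. a \<le> b \<longrightarrow> cmod (f b - f a) \<le> v b - v a)"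

text \<open>Increments of $f$ are bounded by $\int|f'| \le 1 + \int|f'|^2$. The sup bound follows by averaging
  $|f(t)| \le |f(s)| + \int|f'|$ over $s$.\<close>

lemma H1_bounds:
  assumes "f \<in> H1" 
    and R: "(LINT t:{0..1}|lborel. (cmod (f t))\<^sup>2 + (cmod (weak_deriv f t))\<^sup>2) \<le> R"
  shows "\<exists>v. variation_majorant f v \<and> v 1 \<le> 1 + R"
    and "\<forall>t\<in>{0..1}. cmod (f t) \<le> 2 + 2 * R"
proof -
  define g where "g = weak_deriv f"
  have cf: "continuous_on {0..1} f" using assms(1) by (simp add: H1_def)
  have g: "square_integrable g" and w: "is_weak_deriv f g"
    using assms(1) someI_ex[of "\<lambda>g. square_integrable g \<and> is_weak_deriv f g"]
    unfolding H1_def g_def weak_deriv_def by auto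
  note gi = square_integrable_imp_integrable[OF g]
  have if2: "set_integrable lborel {0..1} (\<lambda>t. (cmod (f t))\<^sup>2)"
    by (intro borel_integrable_atLeastAtMost' continuous_intros cf)
  have ig2: "set_integrable lborel {0..1} (\<lambda>t. (cmod (g t))\<^sup>2)"
    using g by (simp add: square_integrable_def)
  have sf: "square_integrable f" unfolding square_integrable_def 
    using if2 borel_integrable_atLeastAtMost'[OF cf] 
    by (auto simp: set_integrable_def set_borel_measurable_def)
  have pos: "0 \<le> (LINT t:{0..1}|lborel. (cmod (h t))\<^sup>2)" for h :: "real \<Rightarrow> complex"
    unfolding set_lebesgue_integral_def by (intro Bochner_Integration.integral_nonneg) auto
  have "(LINT t:{0..1}|lborel. (cmod (f t))\<^sup>2) + (LINT t:{0..1}|lborel. (cmod (g t))\<^sup>2) \<le> R"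
    using R unfolding g_def[symmetric] by (simp add: set_integral_add[OF if2 ig2])
  then have f2: "(LINT t:{0..1}|lborel. (cmod (f t))\<^sup>2) \<le> R" 
    and g2: "(LINT t:{0..1}|lborel. (cmod (g t))\<^sup>2) \<le> R"
    using pos[of f] pos[of g] by linarith+
  define v where "v = (\<lambda>x. integral {0..x} (\<lambda>t. cmod (g t)))"
  have ig: "(\<lambda>t. cmod (g t)) integrable_on {0..1}" by (rule set_borel_integral_eq_integral(1)[OF gi(2)])
  have v: "variation_majorant f v" unfolding variation_majorant_def v_def
    using weak_deriv_increment[OF cf g w] indefinite_integral_continuous_1[OF ig] by simp
  have v1: "v 1 \<le> 1 + R" unfolding v_def using gi(3) g2 by linarith
  show "\<exists>v. variation_majorant f v \<and> v 1 \<le> 1 + R" using v v1 by blast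
  have vmono: "v a \<le> v b" if "0 \<le> a" "a \<le> b" "b \<le> 1" for a b
    using v that norm_ge_zero[of "f b - f a"] unfolding variation_majorant_def by (smt (verit) atLeastAtMost_iff)
  show "\<forall>t\<in>{0..1}. cmod (f t) \<le> 2 + 2 * R"
  proof
    fix t :: real assume t: "t \<in> {0..1}"
    have le: "cmod (f t) \<le> cmod (f s) + (1 + R)" if s: "s \<in> {0..1}" for s
    proof -
      have "cmod (f t - f s) \<le> v 1 - v 0"
      proof (cases "s \<le> t")
        case True
        then have "cmod (f t - f s) \<le> v t - v s" using v s t unfolding variation_majorant_def by blast
        then show ?thesis using vmono[of 0 s] vmono[of t 1] s t by auto
      next
        case False
        then have "cmod (f s - f t) \<le> v s - v t" using v s t unfolding variation_majorant_def by auto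
        then show ?thesis using vmono[of 0 t] vmono[of s 1] s t by (auto simp: norm_minus_commute)
      qed
      then show ?thesis using v1 v norm_triangle_sub[of "f t" "f s"] unfolding variation_majorant_def by auto
    qed
    have "integral {0..1} (\<lambda>s::real. cmod (f t)) \<le> integral {0..1} (\<lambda>s. cmod (f s) + (1 + R))"
      by (intro integral_le integrable_continuous_interval continuous_intros cf le)
    also have "\<dots> = integral {0..1} (\<lambda>s. cmod (f s)) + (1 + R)"
      by (subst Henstock_Kurzweil_Integration.integral_add)
         (auto intro!: integrable_continuous_interval continuous_intros cf)
    also have "integral {0..1} (\<lambda>s. cmod (f s)) \<le> 1 + R"
      using square_integrable_imp_integrable(3)[OF sf] f2 by linarith
    finally show "cmod (f t) \<le> 2 + 2 * R" by simp
  qed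
qed

section \<open>Smooth approximation with controlled variation\<close>

lemma moving_integral_deriv:
  fixes F :: "real \<Rightarrow> 'a::banach"
  assumes F: "continuous_on {0..2} F" and h: "0 \<le> h" "h \<le> 1" and t: "t \<in> {0..1}"
  shows "((\<lambda>t. integral {t..t + h} F) has_vector_derivative F (t + h) - F t) (at t within {0..1})"
proof -
  define G where "G = (\<lambda>t. integral {0..t} F)"
  have G: "(G has_vector_derivative F t) (at t within {0..2})" if "t \<in> {0..2}" for t
    unfolding G_def by (rule integral_has_vector_derivative[OF F that])
  have "((\<lambda>t. t + h) has_vector_derivative 1) (at t within {0..1})"
    by (auto intro!: derivative_eq_intros)
  moreover have "(G has_vector_derivative F (t + h)) (at (t + h) within (\<lambda>t. t + h) ` {0..1})"
    by (rule has_vector_derivative_within_subset[OF G]) (use t h in auto)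
  ultimately have "(G \<circ> (\<lambda>t. t + h) has_vector_derivative 1 *\<^sub>R F (t + h)) (at t within {0..1})"
    by (rule vector_diff_chain_within)
  moreover have "(G has_vector_derivative F t) (at t within {0..1})"
    by (rule has_vector_derivative_within_subset[OF G]) (use t in auto)
  ultimately have "((\<lambda>t. G (t + h) - G t) has_vector_derivative F (t + h) - F t) (at t within {0..1})"
    using has_vector_derivative_diff by (fastforce simp: o_def)
  then show ?thesis
  proof (rule has_vector_derivative_transform[OF t, rotated])
    fix s :: real assume "s \<in> {0..1}"
    then show "integral {s..s + h} F = G (s + h) - G s"
      using Henstock_Kurzweil_Integration.integral_combine[of 0 s "s + h" F] h
        integrable_continuous_interval[OF continuous_on_subset[OF F, of "{0..s+h}"]]
      by (auto simp: G_def algebra_simps)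
  qed
qed

text \<open>The approximation is the moving average $p(t) = h^{-1}\int_t^{t+h} f$, with $f$ and $v$ continued
  by constants beyond $1$. Its derivative is a difference quotient of $f$, so $|p'|$ is at most
  the difference quotient of $v$, whose integral telescopes to two averages of $v$ near $1$ and near
  $0$. The bound on $\int|p'|$ is therefore uniform in $h$.\<close>

lemma smooth_approximation:
  assumes f: "continuous_on {0..1} f" and v: "variation_majorant f v" 
    and m: "\<And>t. t \<in> {0..1} \<Longrightarrow> cmod (f t) \<le> m" and \<delta>: "\<delta> > 0"
  shows "\<exists>p p'. continuous_on {0..1} p' \<and>
    (\<forall>t\<in>{0..1}. (p has_vector_derivative p' t) (at t within {0..1})) \<and>
    (\<forall>t\<in>{0..1}. cmod (p t - f t) \<le> \<delta>) \<and> (\<forall>t\<in>{0..1}. cmod (p t) \<le> m) \<and>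
    integral {0..1} (\<lambda>t. cmod (p' t)) \<le> v 1"
proof -
  define F where "F = (\<lambda>t. f (min 1 t))"
  define w where "w = (\<lambda>t. v (min 1 t))"
  have cv: "continuous_on {0..1} v" and v0: "v 0 = 0" using v by (auto simp: variation_majorant_def)
  have inc: "cmod (f b - f a) \<le> v b - v a" if "0 \<le> a" "a \<le> b" "b \<le> 1" for a b
    using v that by (auto simp: variation_majorant_def)
  have vmono: "v a \<le> v b" if "0 \<le> a" "a \<le> b" "b \<le> 1" for a b
    using inc[OF that] norm_ge_zero[of "f b - f a"] by linarith
  have cF: "continuous_on {0..2} F" unfolding F_def
    by (intro continuous_on_compose2[OF f] continuous_intros) auto
  have cw: "continuous_on {0..2} w" unfolding w_def
    by (intro continuous_on_compose2[OF cv] continuous_intros) auto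
  have Fw: "cmod (F b - F a) \<le> w b - w a" if "0 \<le> a" "a \<le> b" for a b
    unfolding F_def w_def using that by (intro inc) auto
  have Fm: "cmod (F t) \<le> m" if "0 \<le> t" for t unfolding F_def using that by (intro m) auto
  obtain d where d: "d > 0" "\<And>s t. s \<in> {0..2} \<Longrightarrow> t \<in> {0..2} \<Longrightarrow> dist s t < d \<Longrightarrow> dist (F s) (F t) < \<delta>"
    using compact_uniformly_continuous[OF cF compact_Icc] \<delta> unfolding uniformly_continuous_on_def by metis
  define h where "h = min 1 (d / 2)"
  have h: "0 < h" "h \<le> 1" "h < d" using d(1) by (auto simp: h_def)
  define p where "p = (\<lambda>t. (1 / h) *\<^sub>R integral {t..t + h} F)"
  define p' where "p' = (\<lambda>t. (1 / h) *\<^sub>R (F (t + h) - F t))"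
  have iF: "F integrable_on {t..t + h}" if "t \<in> {0..1}" for t
    by (rule integrable_continuous_interval, rule continuous_on_subset[OF cF]) (use that h in auto)
  have avg: "cmod (p t - c) \<le> K" if t: "t \<in> {0..1}" and K: "\<And>s. s \<in> {t..t + h} \<Longrightarrow> cmod (F s - c) \<le> K" for t c K
  proof -
    have "p t - c = (1 / h) *\<^sub>R integral {t..t + h} (\<lambda>s. F s - c)"
    proof -
      have "integral {t..t + h} (\<lambda>s. F s - c) = integral {t..t + h} F - h *\<^sub>R c"
        using Henstock_Kurzweil_Integration.integral_diff[OF iF[OF t] integrable_const_ivl[of c t "t + h"]] h by simp
      then show ?thesis using h by (simp add: p_def scaleR_diff_right)
    qed
    moreover have "cmod (integral {t..t + h} (\<lambda>s. F s - c)) \<le> integral {t..t + h} (\<lambda>s. K)"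
      using iF[OF t] K by (intro integral_norm_bound_integral integrable_diff) auto
    ultimately show ?thesis using h by (simp add: field_simps)
  qed
  have "continuous_on {0..1} p'" unfolding p'_def
    by (intro continuous_intros continuous_on_compose2[OF cF] continuous_on_subset[OF cF]) (use h in auto)
  moreover have "(p has_vector_derivative p' t) (at t within {0..1})" if "t \<in> {0..1}" for t
    unfolding p_def p'_def using h that
    by (intro moving_integral_deriv cF bounded_linear.has_vector_derivative[OF bounded_linear_scaleR_right]) auto
  moreover have "cmod (p t - f t) \<le> \<delta>" if t: "t \<in> {0..1}" for t
  proof (rule avg[OF t])
    fix s assume s: "s \<in> {t..t + h}"
    then have "dist (F s) (F t) < \<delta>" using t h by (intro d(2)) (auto simp: dist_real_def)
    then show "cmod (F s - f t) \<le> \<delta>" using t by (simp add: F_def dist_norm)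
  qed
  moreover have "cmod (p t) \<le> m" if t: "t \<in> {0..1}" for t
    using avg[OF t, of 0 m] Fm t by auto
  moreover have "integral {0..1} (\<lambda>t. cmod (p' t)) \<le> v 1"
  proof -
    have I: "((\<lambda>t. w (t + h) - w t) has_integral (integral {1..1 + h} w - integral {0..0 + h} w)) {0..1}"
      by (intro fundamental_theorem_of_calculus moving_integral_deriv cw) (use h in auto)
    have iw: "w integrable_on {t..t + h}" if "t \<in> {0..1}" for t
      by (rule integrable_continuous_interval, rule continuous_on_subset[OF cw]) (use that h in auto)
    have "integral {1..1 + h} w \<le> integral {1..1 + h} (\<lambda>_. v 1)"
      by (intro integral_le iw) (auto simp: w_def)
    moreover have "0 \<le> integral {0..0 + h} w"
      using vmono[of 0] v0 h by (intro Henstock_Kurzweil_Integration.integral_nonneg iw) (auto simp: w_def)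
    ultimately have le: "integral {1..1 + h} w - integral {0..0 + h} w \<le> h * v 1" using h by simp
    have "integral {0..1} (\<lambda>t. cmod (p' t)) \<le> integral {0..1} (\<lambda>t. (1 / h) * (w (t + h) - w t))"
    proof (rule integral_le)
      show "(\<lambda>t. cmod (p' t)) integrable_on {0..1}"
        by (intro integrable_continuous_interval continuous_intros \<open>continuous_on {0..1} p'\<close>)
      show "(\<lambda>t. (1 / h) * (w (t + h) - w t)) integrable_on {0..1}"
        using has_integral_mult_right[OF I] by blast
      show "cmod (p' t) \<le> (1 / h) * (w (t + h) - w t)" if "t \<in> {0..1}" for t
        using Fw[of t "t + h"] that h by (simp add: p'_def divide_right_mono)
    qed
    also have "\<dots> = (1 / h) * (integral {1..1 + h} w - integral {0..0 + h} w)"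
      by (rule integral_unique[OF has_integral_mult_right[OF I]])
    also have "\<dots> \<le> (1 / h) * (h * v 1)" using le h by (intro mult_left_mono) auto
    finally show ?thesis using h by simp
  qed
  ultimately show ?thesis by blast
qed

section \<open>Linear systems depending polynomially on a parameter\<close>

text \<open>The polynomials in $l$ whose coefficients are continuous functions of $t \in [0,1]$. The class is
  generated inductively, which makes its closure under products and under integration in $t$, and
  so the holomorphy of Picard iterates, immediate inductions without any differentiation under
  the integral sign. Rule \<open>cong\<close> makes values outside $[0,1]$ irrelevant.\<close>

inductive poly_curve :: "(complex \<Rightarrow> real \<Rightarrow> complex) \<Rightarrow> bool" where
  coeff: "continuous_on {0..1} c \<Longrightarrow> poly_curve (\<lambda>l t. c t)"
| add: "poly_curve f \<Longrightarrow> poly_curve g \<Longrightarrow> poly_curve (\<lambda>l t. f l t + g l t)"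
| param: "poly_curve f \<Longrightarrow> poly_curve (\<lambda>l t. l * f l t)"
| cong: "poly_curve f \<Longrightarrow> (\<And>l t. t \<in> {0..1} \<Longrightarrow> g l t = f l t) \<Longrightarrow> poly_curve g"

lemma poly_curve_continuous: "poly_curve f \<Longrightarrow> continuous_on {0..1} (f l)"
proof (induction arbitrary: l rule: poly_curve.induct)
  case (cong f g)
  then show ?case using continuous_on_cong[of "{0..1}" "{0..1}" "g l" "f l"] by simp
qed (auto intro!: continuous_intros)

lemma poly_curve_holomorphic: "poly_curve f \<Longrightarrow> t \<in> {0..1} \<Longrightarrow> (\<lambda>l. f l t) holomorphic_on UNIV"
  by (induction rule: poly_curve.induct) (auto intro!: holomorphic_intros)

lemma poly_curve_mult:
  assumes "poly_curve f" "poly_curve g"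
  shows "poly_curve (\<lambda>l t. f l t * g l t)"
  using assms(1)
proof (induction rule: poly_curve.induct)
  case (coeff c)
  show ?case using assms(2)
  proof (induction rule: poly_curve.induct)
    case (coeff d)
    then show ?case using \<open>continuous_on {0..1} c\<close>
      by (intro poly_curve.coeff continuous_intros)
  next
    case (add f g)
    then show ?case by (simp add: distrib_left poly_curve.add)
  next
    case (param f)
    from poly_curve.param[OF param.IH] show ?case by (simp add: mult.left_commute)
  next
    case (cong f g)
    then show ?case by (auto intro: poly_curve.cong[OF cong.IH])
  qed
next
  case (add f g)
  then show ?case by (simp add: distrib_right poly_curve.add)
next
  case (param f)
  from poly_curve.param[OF param.IH] show ?case by (simp add: mult.assoc)
next
  case (cong f g)
  then show ?case by (auto intro: poly_curve.cong[OF cong.IH])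
qed

lemma poly_curve_sum:
  "finite S \<Longrightarrow> (\<And>i. i \<in> S \<Longrightarrow> poly_curve (f i)) \<Longrightarrow> poly_curve (\<lambda>l t. \<Sum>i\<in>S. f i l t)"
proof (induction S rule: finite_induct)
  case empty
  then show ?case using poly_curve.coeff[of "\<lambda>t. 0"] by simp
qed (auto intro: poly_curve.add)

lemma poly_curve_integral: "poly_curve f \<Longrightarrow> poly_curve (\<lambda>l t. integral {0..t} (f l))"
proof (induction rule: poly_curve.induct)
  case (coeff c)
  then show ?case
    by (intro poly_curve.coeff indefinite_integral_continuous_1 integrable_continuous_interval)
next
  case (add f g)
  have int: "h l integrable_on {0..t}" if "poly_curve h" "t \<in> {0..1}" for h l t
    using continuous_on_subset[OF poly_curve_continuous[OF that(1), of l], of "{0..t}"] that(2)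
    by (intro integrable_continuous_interval) auto
  show ?case
    by (rule poly_curve.cong[OF poly_curve.add[OF add.IH]])
       (use add.hyps in \<open>auto intro!: Henstock_Kurzweil_Integration.integral_add int\<close>)
next
  case (param f)
  from poly_curve.param[OF param.IH] show ?case by simp
next
  case (cong f g)
  show ?case
    by (rule poly_curve.cong[OF cong.IH])
       (use cong.hyps in \<open>auto intro!: Henstock_Kurzweil_Integration.integral_cong\<close>)
qed

lemma poly_curve_bounded:
  "poly_curve f \<Longrightarrow> \<exists>K\<ge>0. \<forall>l t. cmod l \<le> \<rho> \<longrightarrow> t \<in> {0..1} \<longrightarrow> cmod (f l t) \<le> K"
proof (induction rule: poly_curve.induct)
  case (coeff c)
  have "bounded (c ` {0..1})"
    by (intro compact_imp_bounded compact_continuous_image coeff compact_Icc)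
  then obtain K where "\<forall>x\<in>c ` {0..1}. cmod x \<le> K" unfolding bounded_iff by blast
  then show ?case by (intro exI[of _ "\<bar>K\<bar>"]) force
next
  case (add f g)
  then obtain K L where "K \<ge> 0" "L \<ge> 0" 
      "\<And>l t. cmod l \<le> \<rho> \<Longrightarrow> t \<in> {0..1} \<Longrightarrow> cmod (f l t) \<le> K"
      "\<And>l t. cmod l \<le> \<rho> \<Longrightarrow> t \<in> {0..1} \<Longrightarrow> cmod (g l t) \<le> L" by metis
  then show ?case by (intro exI[of _ "K + L"]) (auto intro!: norm_triangle_mono)
next
  case (param f)
  then obtain K where "K \<ge> 0"
      "\<And>l t. cmod l \<le> \<rho> \<Longrightarrow> t \<in> {0..1} \<Longrightarrow> cmod (f l t) \<le> K" by metis
  then show ?case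
    by (intro exI[of _ "\<bar>\<rho>\<bar> * K"]) (auto simp: norm_mult intro!: mult_mono)
qed metis

text \<open>The factorial gain of iterated Volterra operators. It gives the convergence of the Picard series, and
  also, applied to a constant sequence, the uniqueness of solutions.\<close>

lemma iterated_integral_bound:
  fixes \<phi> :: "nat \<Rightarrow> real \<Rightarrow> real"
  assumes "\<And>t. t \<in> {0..1} \<Longrightarrow> \<phi> 0 t \<le> D"
    and "\<And>n t. t \<in> {0..1} \<Longrightarrow> \<phi> (Suc n) t \<le> K * integral {0..t} (\<phi> n)"
    and "\<And>n. continuous_on {0..1} (\<phi> n)" and "K \<ge> 0" and "t \<in> {0..1}"
  shows "\<phi> n t \<le> D * (K * t) ^ n / fact n"
  using assms(5)
proof (induction n arbitrary: t)
  case 0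
  then show ?case using assms(1) by simp
next
  case (Suc n)
  have int: "((\<lambda>s. D * (K * s) ^ n / fact n) has_integral 
              (D * K ^ n / fact n * (t ^ Suc n / Suc n))) {0..t}"
  proof -
    have "((\<lambda>s. s ^ n) has_integral (t ^ Suc n / Suc n - 0 ^ Suc n / Suc n)) {0..t}"
    proof (rule fundamental_theorem_of_calculus)
      show "((\<lambda>s. s ^ Suc n / Suc n) has_vector_derivative s ^ n) (at s within {0..t})" for s
        unfolding has_real_derivative_iff_has_vector_derivative[symmetric]
        by (rule derivative_eq_intros refl | simp)+
    qed (use Suc.prems in auto)
    from has_integral_mult_right[OF this, of "D * K ^ n / fact n"]
    show ?thesis by (simp add: power_mult_distrib mult_ac)
  qed
  have "integral {0..t} (\<phi> n) \<le> D * K ^ n / fact n * (t ^ Suc n / Suc n)"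
  proof (rule has_integral_le[OF integrable_integral int])
    show "\<phi> n integrable_on {0..t}" using Suc.prems
      by (intro integrable_continuous_interval continuous_on_subset[OF assms(3)]) auto
  qed (use Suc in auto)
  then have "\<phi> (Suc n) t \<le> K * (D * K ^ n / fact n * (t ^ Suc n / Suc n))"
    using assms(2)[OF Suc.prems, of n] mult_left_mono[OF _ \<open>K \<ge> 0\<close>] by force
  also have "\<dots> = D * (K * t) ^ Suc n / fact (Suc n)"
    by (simp add: power_mult_distrib field_simps)
  finally show ?case .
qed

definition linear_solution ::
    "('n::finite \<Rightarrow> 'n \<Rightarrow> real \<Rightarrow> complex) \<Rightarrow> ('n \<Rightarrow> real \<Rightarrow> complex) \<Rightarrow> bool" where
  "linear_solution A x \<longleftrightarrow> (\<forall>t\<in>{0..1}. \<forall>i.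
     (x i has_vector_derivative (\<Sum>j\<in>UNIV. A i j t * x j t)) (at t within {0..1}))"

lemma linear_solution_continuous: "linear_solution A x \<Longrightarrow> continuous_on {0..1} (x i)"
  unfolding linear_solution_def continuous_on_eq_continuous_within
  by (meson has_vector_derivative_continuous)

lemma linear_solution_integral:
  assumes "linear_solution A x" "t \<in> {0..1}"
  shows "((\<lambda>s. \<Sum>j\<in>UNIV. A i j s * x j s) has_integral (x i t - x i 0)) {0..t}"
  using assms unfolding linear_solution_def
  by (intro fundamental_theorem_of_calculus)
     (auto intro: has_vector_derivative_within_subset[of _ _ _ "{0..1}"])

lemma linear_system_integral_bound:
  fixes A :: "'n::finite \<Rightarrow> 'n \<Rightarrow> real \<Rightarrow> complex"
  assumes A: "\<And>i j s. s \<in> {0..1} \<Longrightarrow> cmod (A i j s) \<le> K" 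
    and cA: "\<And>i j. continuous_on {0..1} (A i j)" and cx: "\<And>j. continuous_on {0..1} (x j)"
    and t: "t \<in> {0..1}"
  shows "cmod (integral {0..t} (\<lambda>s. \<Sum>j\<in>UNIV. A i j s * x j s)) 
         \<le> K * integral {0..t} (\<lambda>s. \<Sum>j\<in>UNIV. cmod (x j s))"
proof -
  have sub: "{0..t} \<subseteq> {0..1}" using t by auto
  have "cmod (integral {0..t} (\<lambda>s. \<Sum>j\<in>UNIV. A i j s * x j s)) 
        \<le> integral {0..t} (\<lambda>s. K * (\<Sum>j\<in>UNIV. cmod (x j s)))"
  proof (rule integral_norm_bound_integral)
    fix s assume "s \<in> {0..t}"
    then have "s \<in> {0..1}" using t by auto
    then show "cmod (\<Sum>j\<in>UNIV. A i j s * x j s) \<le> K * (\<Sum>j\<in>UNIV. cmod (x j s))"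
      unfolding sum_distrib_left
      by (intro sum_norm_le) (auto simp: norm_mult intro!: mult_right_mono A)
  qed (intro integrable_continuous_interval continuous_intros continuous_on_subset[OF cA sub]
        continuous_on_subset[OF cx sub])+
  then show ?thesis by simp
qed

text \<open>The norm $\phi$ of the difference of two solutions satisfies $\phi \le NK\int_0^t\phi$; iterating this bounds
  $\phi$ by the terms of an exponential series.\<close>

lemma linear_solution_unique:
  fixes A :: "'n::finite \<Rightarrow> 'n \<Rightarrow> real \<Rightarrow> complex"
  assumes cA: "\<And>i j. continuous_on {0..1} (A i j)"
    and x: "linear_solution A x" and y: "linear_solution A y"
    and init: "\<And>i. x i 0 = y i 0" and t: "t \<in> {0..1}"
  shows "x i t = y i t"
proof -
  define z where "z = (\<lambda>i t. x i t - y i t)"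
  define \<phi> where "\<phi> = (\<lambda>t. \<Sum>i\<in>UNIV. cmod (z i t))"
  have z: "linear_solution A z"
    using x y unfolding linear_solution_def z_def
    by (auto simp: right_diff_distrib sum_subtractf intro!: has_vector_derivative_diff)
  have z0: "z i 0 = 0" for i by (simp add: z_def init)
  have cz: "continuous_on {0..1} (z i)" for i by (rule linear_solution_continuous[OF z])
  then have c\<phi>: "continuous_on {0..1} \<phi>" unfolding \<phi>_def by (intro continuous_intros)
  have "\<exists>K\<ge>0. \<forall>s\<in>{0..1}. \<forall>i j. cmod (A i j s) \<le> K"
  proof -
    have "bounded (\<Union>i j. A i j ` {0..1})"
      by (intro bounded_UN finite ballI compact_imp_bounded compact_continuous_image cA compact_Icc)
    then obtain K where "\<forall>x\<in>(\<Union>i j. A i j ` {0..1}). cmod x \<le> K" unfolding bounded_iff by blast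
    then have "cmod (A i j s) \<le> \<bar>K\<bar>" if "s \<in> {0..1}" for i j s
      using that by (intro order_trans[OF _ abs_ge_self]) blast
    then show ?thesis by (intro exI[of _ "\<bar>K\<bar>"]) auto
  qed
  then obtain K where K: "K \<ge> 0" "\<And>i j s. s \<in> {0..1} \<Longrightarrow> cmod (A i j s) \<le> K" by blast
  define N where "N = real CARD('n)"
  have step: "\<phi> s \<le> N * K * integral {0..s} \<phi>" if "s \<in> {0..1}" for s
  proof -
    have "cmod (z i s) \<le> K * integral {0..s} \<phi>" for i
      using linear_system_integral_bound[where A=A and i=i and x=z, OF K(2) cA cz that]
        integral_unique[OF linear_solution_integral[OF z that, of i]] z0[of i]
      by (simp add: \<phi>_def)
    then have "\<phi> s \<le> of_nat (card (UNIV::'n set)) * (K * integral {0..s} \<phi>)"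
      unfolding \<phi>_def[of] by (intro sum_bounded_above) (auto simp: \<phi>_def)
    then show ?thesis by (simp add: N_def)
  qed
  have "bounded (\<phi> ` {0..1})" by (intro compact_imp_bounded compact_continuous_image c\<phi> compact_Icc)
  then obtain D where D: "\<And>s. s \<in> {0..1} \<Longrightarrow> \<phi> s \<le> D" 
    unfolding bounded_iff by (metis abs_le_D1 image_eqI real_norm_def)
  have "\<phi> t \<le> D * (N * K * t) ^ n / fact n" for n
    using iterated_integral_bound[of "\<lambda>_. \<phi>" D "N * K" t n] D step c\<phi> K(1) t
    by (simp add: N_def)
  moreover have "(\<lambda>n. D * (N * K * t) ^ n / fact n) \<longlonglongrightarrow> 0"
  proof -
    have "(\<lambda>n. inverse (fact n) * (N * K * t) ^ n) \<longlonglongrightarrow> 0"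
      using summable_LIMSEQ_zero[OF summable_exp[of "N * K * t"]] .
    from tendsto_mult_right_zero[OF this, of D] show ?thesis by (simp add: field_simps)
  qed
  ultimately have "\<phi> t \<le> 0" by (intro LIMSEQ_le_const) auto
  moreover have "cmod (z i t) \<le> \<phi> t" unfolding \<phi>_def by (intro member_le_sum) auto
  ultimately have "cmod (z i t) \<le> 0" by linarith
  then show ?thesis by (simp add: z_def)
qed

lemma uniform_limit_sum:
  fixes f :: "'i \<Rightarrow> 'b \<Rightarrow> 'c \<Rightarrow> 'd::real_normed_vector"
  assumes "finite I" "\<And>i. i \<in> I \<Longrightarrow> uniform_limit S (f i) (g i) F"
  shows "uniform_limit S (\<lambda>n x. \<Sum>i\<in>I. f i n x) (\<lambda>x. \<Sum>i\<in>I. g i x) F"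
  using assms by (induction I rule: finite_induct) (auto intro!: uniform_limit_intros)

text \<open>The solution is the sum of the Picard series \<open>X\<close>, whose terms are polynomials in $l$. It converges
  uniformly in $t$ for fixed $l$, which gives the integral equation, and uniformly on
  discs in $l$ for fixed $t$, which gives holomorphy.\<close>

theorem linear_solution_exists_holomorphic:
  fixes A :: "'n::finite \<Rightarrow> 'n \<Rightarrow> complex \<Rightarrow> real \<Rightarrow> complex" and x0 :: "'n \<Rightarrow> complex"
  assumes A: "\<And>i j. poly_curve (A i j)"
  shows "\<exists>x. (\<forall>l. linear_solution (\<lambda>i j. A i j l) (\<lambda>i. x i l)) \<and> (\<forall>l i. x i l 0 = x0 i) \<and>
             (\<forall>t\<in>{0..1}. \<forall>i. (\<lambda>l. x i l t) holomorphic_on UNIV)"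
proof -
  define X where "X = rec_nat (\<lambda>i l t. x0 i) 
    (\<lambda>n X i l t. integral {0..t} (\<lambda>s. \<Sum>j\<in>UNIV. A i j l s * X j l s))"
  have X0: "X 0 = (\<lambda>i l t. x0 i)" 
    and XS: "X (Suc n) = (\<lambda>i l t. integral {0..t} (\<lambda>s. \<Sum>j\<in>UNIV. A i j l s * X n j l s))" for n
    by (simp_all add: X_def)
  have pX: "poly_curve (X n i)" for n i
  proof (induction n arbitrary: i)
    case 0
    then show ?case by (simp add: X0 poly_curve.coeff)
  next
    case (Suc n)
    then show ?case unfolding XS
      by (intro poly_curve_integral poly_curve_sum poly_curve_mult A finite)
  qed
  note cX = poly_curve_continuous[OF pX] and cA = poly_curve_continuous[OF A]
  define N where "N = real CARD('n)"
  define D where "D = (\<Sum>i\<in>UNIV. cmod (x0 i))"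
  have bound: "\<exists>K\<ge>0. \<forall>l t n i. cmod l \<le> \<rho> \<longrightarrow> t \<in> {0..1} \<longrightarrow> cmod (X n i l t) \<le> D * K ^ n / fact n" for \<rho>
  proof -
    have "\<exists>K. \<forall>i j. K i j \<ge> 0 \<and> (\<forall>l t. cmod l \<le> \<rho> \<longrightarrow> t \<in> {0..1} \<longrightarrow> cmod (A i j l t) \<le> K i j)"
      using poly_curve_bounded[OF A] by metis
    then obtain k where k0: "\<And>i j. k i j \<ge> 0" 
      and k: "\<And>i j l t. cmod l \<le> \<rho> \<Longrightarrow> t \<in> {0..1} \<Longrightarrow> cmod (A i j l t) \<le> k i j" by blast
    define K where "K = (\<Sum>i\<in>UNIV. \<Sum>j\<in>UNIV. k i j)"
    have K0: "K \<ge> 0" unfolding K_def by (intro sum_nonneg k0)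
    have "k i j \<le> K" for i j
    proof -
      have "k i j \<le> (\<Sum>j\<in>UNIV. k i j)" by (intro member_le_sum k0) auto
      also have "\<dots> \<le> K" unfolding K_def by (intro member_le_sum[where f="\<lambda>i. \<Sum>j\<in>UNIV. k i j"] sum_nonneg k0) auto
      finally show ?thesis .
    qed
    then have AK: "cmod (A i j l t) \<le> K" if "cmod l \<le> \<rho>" "t \<in> {0..1}" for i j l t
      using k[OF that, of i j] order_trans by blast
    have "cmod (X n i l t) \<le> D * (N * K) ^ n / fact n" if l: "cmod l \<le> \<rho>" and t: "t \<in> {0..1}" for n i l t
    proof -
      define \<phi> where "\<phi> = (\<lambda>n t. \<Sum>i\<in>UNIV. cmod (X n i l t))"
      have "\<phi> n t \<le> D * (N * K * t) ^ n / fact n"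
      proof (rule iterated_integral_bound)
        fix n s assume s: "s \<in> {0..1::real}"
        show "\<phi> 0 s \<le> D" by (simp add: \<phi>_def X0 D_def)
        have "cmod (X (Suc n) i l s) \<le> K * integral {0..s} (\<phi> n)" for i
          unfolding XS \<phi>_def by (rule linear_system_integral_bound[OF AK[OF l] cA cX s])
        then have "\<phi> (Suc n) s \<le> of_nat (card (UNIV::'n set)) * (K * integral {0..s} (\<phi> n))"
          unfolding \<phi>_def[of] by (intro sum_bounded_above) (auto simp: \<phi>_def)
        then show "\<phi> (Suc n) s \<le> N * K * integral {0..s} (\<phi> n)" by (simp add: N_def)
      qed (use t K0 in \<open>auto simp: \<phi>_def N_def intro!: continuous_intros cX\<close>)
      also have "\<dots> \<le> D * (N * K) ^ n / fact n"
        using t K0 by (intro divide_right_mono mult_left_mono power_mono) 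
          (auto simp: D_def N_def sum_nonneg mult_left_le)
      finally have "\<phi> n t \<le> D * (N * K) ^ n / fact n" .
      moreover have "cmod (X n i l t) \<le> \<phi> n t" unfolding \<phi>_def by (intro member_le_sum) auto
      ultimately show ?thesis by linarith
    qed
    then show ?thesis using K0 by (intro exI[of _ "N * K"]) (auto simp: N_def)
  qed
  define x where "x = (\<lambda>i l t. \<Sum>n. X n i l t)"
  have sm: "summable (\<lambda>n. D * K ^ n / fact n)" for K
    using summable_mult[OF summable_exp[of K], of D] by (simp add: field_simps)
  have unif_l: "uniform_limit (cball 0 \<rho>) (\<lambda>n l. \<Sum>k<n. X k i l t) (\<lambda>l. x i l t) sequentially" 
    if "t \<in> {0..1}" for i t \<rho>
  proof -
    obtain K where "\<And>l t n i. cmod l \<le> \<rho> \<Longrightarrow> t \<in> {0..1} \<Longrightarrow> cmod (X n i l t) \<le> D * K ^ n / fact n"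
      using bound by metis
    then show ?thesis unfolding x_def using that
      by (intro Weierstrass_m_test[OF _ sm]) auto
  qed
  have unif_t: "uniform_limit {0..1} (\<lambda>n t. \<Sum>k<n. X k i l t) (\<lambda>t. x i l t) sequentially" for i l
  proof -
    obtain K where "\<And>t n i. t \<in> {0..1} \<Longrightarrow> cmod (X n i l t) \<le> D * K ^ n / fact n"
      using bound[of "cmod l"] by blast
    then show ?thesis unfolding x_def by (intro Weierstrass_m_test[OF _ sm]) auto
  qed
  have hol: "(\<lambda>l. x i l t) holomorphic_on UNIV" if t: "t \<in> {0..1}" for i t
  proof (rule holomorphic_uniform_sequence)
    show "(\<lambda>l. \<Sum>k<n. X k i l t) holomorphic_on UNIV" for n
      by (intro holomorphic_intros poly_curve_holomorphic[OF pX t])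
    fix l :: complex
    have "cball l 1 \<subseteq> cball 0 (cmod l + 1)" 
      by (intro cball_subset_cball_iff[THEN iffD2]) simp
    then show "\<exists>d>0. cball l d \<subseteq> UNIV \<and> 
        uniform_limit (cball l d) (\<lambda>n l. \<Sum>k<n. X k i l t) (\<lambda>l. x i l t) sequentially"
      by (intro exI[of _ 1]) (auto intro: uniform_limit_on_subset[OF unif_l[OF t]])
  qed auto
  have cx: "continuous_on {0..1} (x i l)" for i l
    by (rule uniform_limit_theorem[OF _ unif_t]) (auto intro!: always_eventually continuous_intros cX)
  have x_int: "x i l t = x0 i + integral {0..t} (\<lambda>s. \<Sum>j\<in>UNIV. A i j l s * x j l s)" 
    if t: "t \<in> {0..1}" for i l t
  proof -
    have sub: "{0..t} \<subseteq> {0..1}" using t by auto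
    define P where "P = (\<lambda>n i t. \<Sum>k<n. X k i l t)"
    have cP: "continuous_on {0..1} (P n j)" for n j unfolding P_def by (intro continuous_intros cX)
    have PS: "P (Suc n) i t = x0 i + integral {0..t} (\<lambda>s. \<Sum>j\<in>UNIV. A i j l s * P n j s)" for n
    proof -
      have "P (Suc n) i t = x0 i + (\<Sum>k<n. X (Suc k) i l t)"
        unfolding P_def by (simp only: sum.lessThan_Suc_shift X0)
      also have "(\<Sum>k<n. X (Suc k) i l t) = 
          integral {0..t} (\<lambda>s. \<Sum>k<n. \<Sum>j\<in>UNIV. A i j l s * X k j l s)"
        unfolding XS 
        by (intro Henstock_Kurzweil_Integration.integral_sum[symmetric] integrable_continuous_interval continuous_intros 
              continuous_on_subset[OF cA sub] continuous_on_subset[OF cX sub]) auto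
      also have "(\<lambda>s. \<Sum>k<n. \<Sum>j\<in>UNIV. A i j l s * X k j l s) = 
                 (\<lambda>s. \<Sum>j\<in>UNIV. A i j l s * P n j s)"
        unfolding P_def sum_distrib_left by (subst sum.swap) simp
      finally show ?thesis .
    qed
    have bA: "bounded (A i j l ` {0..t})" for j
      by (intro compact_imp_bounded compact_continuous_image continuous_on_subset[OF cA sub] compact_Icc)
    have bx: "bounded (x j l ` {0..t})" for j
      by (intro compact_imp_bounded compact_continuous_image continuous_on_subset[OF cx sub] compact_Icc)
    have "uniform_limit {0..t} (\<lambda>n s. \<Sum>j\<in>UNIV. A i j l s * P n j s) 
                              (\<lambda>s. \<Sum>j\<in>UNIV. A i j l s * x j l s) sequentially"
      unfolding P_def
      by (intro uniform_limit_sum finite uniform_lim_mult uniform_limit_const bA bx 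
            uniform_limit_on_subset[OF unif_t sub])
    moreover have "continuous_on {0..t} (\<lambda>s. \<Sum>j\<in>UNIV. A i j l s * P n j s)" for n
      by (intro continuous_intros continuous_on_subset[OF cA sub] continuous_on_subset[OF cP sub])
    ultimately obtain I J where 
      I: "\<And>n. ((\<lambda>s. \<Sum>j\<in>UNIV. A i j l s * P n j s) has_integral I n) {0..t}"
      and J: "((\<lambda>s. \<Sum>j\<in>UNIV. A i j l s * x j l s) has_integral J) {0..t}" and IJ: "I \<longlonglongrightarrow> J"
      by (rule uniform_limit_integral) auto
    have "(\<lambda>n. P (Suc n) i t) \<longlonglongrightarrow> x0 i + J" 
      unfolding PS integral_unique[OF I] by (intro tendsto_intros IJ)
    moreover have "(\<lambda>n. P n i t) \<longlonglongrightarrow> x i l t"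
      unfolding P_def by (rule tendsto_uniform_limitI[OF unif_t t])
    ultimately show ?thesis 
      using LIMSEQ_unique LIMSEQ_Suc integral_unique[OF J] by blast
  qed
  have "linear_solution (\<lambda>i j. A i j l) (\<lambda>i. x i l)" for l
    unfolding linear_solution_def
  proof (intro ballI allI)
    fix t :: real and i assume t: "t \<in> {0..1}"
    have "((\<lambda>t. integral {0..t} (\<lambda>s. \<Sum>j\<in>UNIV. A i j l s * x j l s)) has_vector_derivative
            (\<Sum>j\<in>UNIV. A i j l t * x j l t)) (at t within {0..1})"
      by (rule integral_has_vector_derivative[OF _ t]) (intro continuous_intros cA cx)
    then have "((\<lambda>t. x0 i + integral {0..t} (\<lambda>s. \<Sum>j\<in>UNIV. A i j l s * x j l s)) has_vector_derivative
            (\<Sum>j\<in>UNIV. A i j l t * x j l t)) (at t within {0..1})"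
      by (auto intro!: derivative_eq_intros)
    then show "(x i l has_vector_derivative (\<Sum>j\<in>UNIV. A i j l t * x j l t)) (at t within {0..1})"
      by (rule has_vector_derivative_transform[OF t, rotated]) (rule x_int)
  qed
  moreover have "x i l 0 = x0 i" for i l using x_int[of 0 i l] by simp
  ultimately show ?thesis using hol by blast
qed

section \<open>Asymptotics of a single column\<close>

definition lax_column_system :: "complex \<Rightarrow> (real \<Rightarrow> complex) \<Rightarrow> (real \<Rightarrow> complex) \<Rightarrow> (real \<Rightarrow> complex) \<Rightarrow>
    (real \<Rightarrow> complex) \<Rightarrow> (real \<Rightarrow> complex) \<Rightarrow> (real \<Rightarrow> complex) \<Rightarrow> bool" where
  "lax_column_system l f1 f2 f3 f4 u v \<longleftrightarrow> (\<forall>t\<in>{0..1}.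
     (u has_vector_derivative (- 2 * \<i> * l\<^sup>2 - \<i> * f1 t * f2 t) * u t + (2 * l * f1 t + \<i> * f3 t) * v t)
       (at t within {0..1}) \<and>
     (v has_vector_derivative (2 * l * f2 t - \<i> * f4 t) * u t + (2 * \<i> * l\<^sup>2 + \<i> * f1 t * f2 t) * v t)
       (at t within {0..1}))"

text \<open>The symmetry that exchanges the two rows of the system and changes the sign of $l^2$. It
  reduces the estimate of the second component to that of the first.\<close>

lemma lax_column_system_swap:
  assumes "lax_column_system l f1 f2 f3 f4 u v"
  shows "lax_column_system (\<i> * l) (\<lambda>t. - \<i> * f2 t) (\<lambda>t. - \<i> * f1 t) (\<lambda>t. - f4 t) (\<lambda>t. - f3 t) v u"
proof -
  have "\<i> * (\<i> * z) = - z" for z by (simp flip: mult.assoc)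
  then show ?thesis using assms unfolding lax_column_system_def
    by (simp add: algebra_simps power_mult_distrib)
qed

text \<open>The coefficient $q$ solving $4il^2q + 2lp_1 + ip_3 = 0$, so that in the equation for $u + qv$ the
  coupling terms of size $|l|$ and of size $1$ cancel up to the errors $p_j - f_j$.\<close>

definition gauge_coeff :: "complex \<Rightarrow> (real \<Rightarrow> complex) \<Rightarrow> (real \<Rightarrow> complex) \<Rightarrow> real \<Rightarrow> complex" where
  "gauge_coeff l p1 p3 t = \<i> * p1 t / (2 * l) - p3 t / (4 * l\<^sup>2)"

lemma gauge_coeff_bound:
  assumes "cmod (f t) \<le> a" "cmod (g t) \<le> b" "1 \<le> cmod l"
  shows "cmod (gauge_coeff l f g t) \<le> (a + b) / (2 * cmod l)"
proof -
  have "0 \<le> b" using assms(2) norm_ge_zero order_trans by blast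
  have "cmod (gauge_coeff l f g t) \<le> cmod (f t) / (2 * cmod l) + cmod (g t) / (4 * (cmod l)\<^sup>2)"
    unfolding gauge_coeff_def by (rule order_trans[OF norm_triangle_ineq4]) (simp add: norm_mult norm_divide norm_power)
  also have "\<dots> \<le> a / (2 * cmod l) + b / (2 * cmod l)"
  proof (intro add_mono divide_right_mono frac_le)
    have "cmod l * 1 \<le> cmod l * cmod l" using assms(3) by (intro mult_left_mono) auto
    then show "2 * cmod l \<le> 4 * (cmod l)\<^sup>2" using assms(3) by (simp add: power2_eq_square)
  qed (use assms \<open>0 \<le> b\<close> in auto)
  finally show ?thesis by (simp add: add_divide_distrib)
qed

text \<open>With $n = u + qv$ and $\kappa = -2il^2$ one has $n' = \kappa n + R_a u + R_b v$, and $R_a$, $R_b$ are bounded by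
  a function $r$ with $\int r = O(1/|l|)$. The exponential $e^{\kappa(t-s)}$ from the variation of constants is at
  most $e^{\sigma(t-s)}$, which together with the weight $e^{\sigma s}$ of $u$ and $v$ at time $s$ gives
  exactly $e^{\sigma t}$. The size $W$ of the solution is a parameter here; it
  is determined once both components are available.\<close>

lemma gauged_component_estimate:
  fixes l :: complex
  defines "\<sigma> \<equiv> 2 * \<bar>Im (l\<^sup>2)\<bar>"
  assumes sys: "lax_column_system l f1 f2 f3 f4 u v" and l: "1 \<le> cmod l"
    and fm: "\<And>t. t \<in> {0..1} \<Longrightarrow> cmod (f1 t) \<le> m" "\<And>t. t \<in> {0..1} \<Longrightarrow> cmod (f2 t) \<le> m"
      "\<And>t. t \<in> {0..1} \<Longrightarrow> cmod (f4 t) \<le> m"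
    and p: "\<And>t. t \<in> {0..1} \<Longrightarrow> (p1 has_vector_derivative d1 t) (at t within {0..1})"
      "\<And>t. t \<in> {0..1} \<Longrightarrow> (p3 has_vector_derivative d3 t) (at t within {0..1})"
    and cd: "continuous_on {0..1} d1" "continuous_on {0..1} d3"
    and pm: "\<And>t. t \<in> {0..1} \<Longrightarrow> cmod (p1 t) \<le> m" "\<And>t. t \<in> {0..1} \<Longrightarrow> cmod (p3 t) \<le> m"
    and pf: "\<And>t. t \<in> {0..1} \<Longrightarrow> cmod (p1 t - f1 t) \<le> 1 / (cmod l)\<^sup>2"
      "\<And>t. t \<in> {0..1} \<Longrightarrow> cmod (p3 t - f3 t) \<le> 1 / (cmod l)\<^sup>2"
    and dL: "integral {0..1} (\<lambda>t. cmod (d1 t)) \<le> L" "integral {0..1} (\<lambda>t. cmod (d3 t)) \<le> L"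
    and W: "\<And>t. t \<in> {0..1} \<Longrightarrow> exp (- \<sigma> * t) * (cmod (u t) + cmod (v t)) \<le> W"
    and t: "t \<in> {0..1}"
  shows "exp (- \<sigma> * t) * cmod (u t + gauge_coeff l p1 p3 t * v t 
           - exp (- 2 * \<i> * l\<^sup>2 * of_real t) * (u 0 + gauge_coeff l p1 p3 0 * v 0)) 
         \<le> W * (3 + m + 2 * m\<^sup>2 + m ^ 3 + 2 * L) / cmod l"
proof -
  define \<kappa> where "\<kappa> = - 2 * \<i> * l\<^sup>2"
  define q where "q = gauge_coeff l p1 p3"
  define q' where "q' = gauge_coeff l d1 d3"
  define n where "n = (\<lambda>s. u s + q s * v s)"
  define Ra where "Ra = (\<lambda>s. \<i> * f2 s * (p1 s - f1 s) - p3 s * f2 s / (2 * l) - \<i> * f4 s * q s)"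
  define Rb where "Rb = (\<lambda>s. 2 * l * (f1 s - p1 s) + \<i> * (f3 s - p3 s) + \<i> * f1 s * f2 s * q s + q' s)"
  define c where "c = 3 + m + 2 * m\<^sup>2 + m ^ 3"
  define r where "r = (\<lambda>s. (c + cmod (d1 s) + cmod (d3 s)) / cmod l)"
  have l0: "l \<noteq> 0" and cl: "cmod l > 0" using l by auto
  have m0: "m \<ge> 0" using order_trans[OF norm_ge_zero fm(1)[of 0]] by simp
  have W0: "W \<ge> 0" using order_trans[OF _ W[of 0]] by simp
  have du: "(u has_vector_derivative (\<kappa> - \<i> * f1 s * f2 s) * u s + (2 * l * f1 s + \<i> * f3 s) * v s) (at s within {0..1})"
    and dv: "(v has_vector_derivative (2 * l * f2 s - \<i> * f4 s) * u s + (- \<kappa> + \<i> * f1 s * f2 s) * v s) (at s within {0..1})"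
    if "s \<in> {0..1}" for s
    using sys that unfolding lax_column_system_def \<kappa>_def by auto
  have dq: "(q has_vector_derivative q' s) (at s within {0..1})" if "s \<in> {0..1}" for s
    unfolding q_def q'_def gauge_coeff_def[abs_def] 
    using has_vector_derivative_diff[OF has_vector_derivative_mult_right[OF p(1)[OF that], of "\<i> / (2 * l)"]
        has_vector_derivative_mult_right[OF p(2)[OF that], of "1 / (4 * l\<^sup>2)"]] by simp
  have dn: "(n has_vector_derivative \<kappa> * n s + (Ra s * u s + Rb s * v s)) (at s within {0..1})" if s: "s \<in> {0..1}" for s
  proof -
    \<comment> \<open>The two identities behind the choice of $q$: the first cancels the diagonal term, the second the coupling.\<close>
    have q1: "q s * (2 * l) = \<i> * p1 s - p3 s / (2 * l)"
      using l0 by (simp add: q_def gauge_coeff_def field_simps power2_eq_square)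
    have q2: "q s * (4 * \<i> * l\<^sup>2) = - (2 * l * p1 s) - \<i> * p3 s"
      using l0 by (simp add: q_def gauge_coeff_def field_simps power2_eq_square)
    have "(n has_vector_derivative ((\<kappa> - \<i> * f1 s * f2 s) * u s + (2 * l * f1 s + \<i> * f3 s) * v s)
        + (q s * ((2 * l * f2 s - \<i> * f4 s) * u s + (- \<kappa> + \<i> * f1 s * f2 s) * v s) + q' s * v s)) (at s within {0..1})"
      unfolding n_def by (intro has_vector_derivative_add has_vector_derivative_mult du dv dq s)
    moreover have "((\<kappa> - \<i> * f1 s * f2 s) * u s + (2 * l * f1 s + \<i> * f3 s) * v s)
        + (q s * ((2 * l * f2 s - \<i> * f4 s) * u s + (- \<kappa> + \<i> * f1 s * f2 s) * v s) + q' s * v s)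
        = \<kappa> * n s + ((- \<i> * f1 s * f2 s + q s * (2 * l) * f2 s - \<i> * f4 s * q s) * u s
           + (2 * l * f1 s + \<i> * f3 s + q s * (4 * \<i> * l\<^sup>2) + \<i> * f1 s * f2 s * q s + q' s) * v s)"
      by (simp add: n_def \<kappa>_def algebra_simps)
    moreover have "- \<i> * f1 s * f2 s + q s * (2 * l) * f2 s - \<i> * f4 s * q s = Ra s"
      unfolding q1 by (simp add: Ra_def algebra_simps)
    moreover have "2 * l * f1 s + \<i> * f3 s + q s * (4 * \<i> * l\<^sup>2) + \<i> * f1 s * f2 s * q s + q' s = Rb s"
      unfolding q2 by (simp add: Rb_def algebra_simps)
    ultimately show ?thesis by simp
  qed
  have qm: "cmod (q s) \<le> m / cmod l" if "s \<in> {0..1}" for s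
    using gauge_coeff_bound[where f=p1 and g=p3 and t=s, OF pm(1)[OF that] pm(2)[OF that] l] by (simp add: q_def)
  have q'm: "cmod (q' s) \<le> (cmod (d1 s) + cmod (d3 s)) / cmod l" for s
    using gauge_coeff_bound[where f=d1 and g=d3 and t=s, OF order_refl order_refl l] cl
    by (simp add: q'_def) (smt (verit) add_nonneg_nonneg divide_right_mono frac_le norm_ge_zero)
  have sq: "1 / (cmod l)\<^sup>2 \<le> 1 / cmod l" 
    using mult_left_mono[OF l, of "cmod l"] cl by (intro frac_le) (auto simp: power2_eq_square)
  have R: "cmod (Ra s) \<le> r s" "cmod (Rb s) \<le> r s" if s: "s \<in> {0..1}" for s
  proof -
    have "cmod (Ra s) \<le> cmod (\<i> * f2 s * (p1 s - f1 s)) + cmod (p3 s * f2 s / (2 * l)) + cmod (\<i> * f4 s * q s)"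
      unfolding Ra_def by (rule order_trans[OF norm_triangle_ineq4 add_right_mono[OF norm_triangle_ineq4]])
    also have "\<dots> \<le> m * (1 / cmod l) + m * m / cmod l + m * (m / cmod l)"
    proof (intro add_mono)
      show "cmod (\<i> * f2 s * (p1 s - f1 s)) \<le> m * (1 / cmod l)"
        unfolding norm_mult using order_trans[OF pf(1)[OF s] sq] fm(2)[OF s] m0 by (intro mult_mono) auto
      have "cmod (p3 s * f2 s / (2 * l)) \<le> m * m / (2 * cmod l)"
        unfolding norm_mult norm_divide using pm(2)[OF s] fm(2)[OF s] m0 cl by (intro frac_le mult_mono) auto
      also have "\<dots> \<le> m * m / cmod l" using cl m0 by (intro frac_le) auto
      finally show "cmod (p3 s * f2 s / (2 * l)) \<le> m * m / cmod l" .
      show "cmod (\<i> * f4 s * q s) \<le> m * (m / cmod l)"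
        unfolding norm_mult using qm[OF s] fm(3)[OF s] m0 by (intro mult_mono) auto
    qed
    also have "\<dots> = (m + 2 * m\<^sup>2) / cmod l" by (simp add: power2_eq_square add_divide_distrib)
    also have "\<dots> \<le> r s" unfolding r_def c_def using cl m0 by (intro divide_right_mono) auto
    finally show "cmod (Ra s) \<le> r s" .
    have "cmod (Rb s) \<le> cmod (2 * l * (f1 s - p1 s)) + cmod (\<i> * (f3 s - p3 s)) 
            + cmod (\<i> * f1 s * f2 s * q s) + cmod (q' s)"
      unfolding Rb_def 
      by (rule order_trans[OF norm_triangle_ineq add_right_mono[OF order_trans[OF norm_triangle_ineq 
            add_right_mono[OF norm_triangle_ineq]]]])
    also have "\<dots> \<le> 2 / cmod l + 1 / cmod l + m * m * (m / cmod l) + (cmod (d1 s) + cmod (d3 s)) / cmod l"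
    proof (intro add_mono q'm)
      have "cmod (2 * l * (f1 s - p1 s)) \<le> 2 * cmod l * (1 / (cmod l)\<^sup>2)"
        unfolding norm_mult using pf(1)[OF s] by (intro mult_mono) (auto simp: norm_minus_commute)
      then show "cmod (2 * l * (f1 s - p1 s)) \<le> 2 / cmod l" using cl by (simp add: power2_eq_square)
      show "cmod (\<i> * (f3 s - p3 s)) \<le> 1 / cmod l"
        using order_trans[OF pf(2)[OF s] sq] by (simp add: norm_mult norm_minus_commute)
      show "cmod (\<i> * f1 s * f2 s * q s) \<le> m * m * (m / cmod l)"
        unfolding norm_mult using qm[OF s] fm(1,2)[OF s] m0 by (intro mult_mono) auto
    qed
    also have "\<dots> = (3 + m ^ 3 + cmod (d1 s) + cmod (d3 s)) / cmod l"
      by (simp add: power3_eq_cube add_divide_distrib)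
    also have "\<dots> \<le> r s" unfolding r_def c_def using cl m0 by (intro divide_right_mono) auto
    finally show "cmod (Rb s) \<le> r s" .
  qed
  have cr: "continuous_on {0..1} r" unfolding r_def by (intro continuous_intros cd) (use cl in auto)
  have r0: "r s \<ge> 0" for s unfolding r_def c_def using m0 by auto
  have Re\<kappa>: "Re \<kappa> \<le> \<sigma>" by (simp add: \<kappa>_def \<sigma>_def)
  \<comment> \<open>The derivative of $e^{\kappa(t-s)} n(s)$ with respect to $s$.\<close>
  define h' where "h' = (\<lambda>s. exp (of_real (t - s) * \<kappa>) * (Ra s * u s + Rb s * v s))"
  have sub: "{0..t} \<subseteq> {0..1}" using t by auto
  have "(h' has_integral (exp (of_real (t - t) * \<kappa>) * n t - exp (of_real (t - 0) * \<kappa>) * n 0)) {0..t}"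
  proof (rule fundamental_theorem_of_calculus)
    fix s assume "s \<in> {0..t}"
    then have s: "s \<in> {0..1}" using t by auto
    have "((\<lambda>s. exp (of_real (t - s) * \<kappa>)) has_vector_derivative exp (of_real (t - s) * \<kappa>) * (- \<kappa>)) (at s within {0..1})"
    proof -
      have "((\<lambda>s. (t - s) *\<^sub>R \<kappa>) has_vector_derivative - \<kappa>) (at s within {0..1})"
        by (auto intro!: derivative_eq_intros simp: has_vector_derivative_def)
      from field_vector_diff_chain_within[OF this DERIV_subset[OF DERIV_exp subset_UNIV]]
      show ?thesis by (simp add: o_def scaleR_conv_of_real mult.commute)
    qed
    then have "((\<lambda>s. exp (of_real (t - s) * \<kappa>) * n s) has_vector_derivative
        (exp (of_real (t - s) * \<kappa>) * (\<kappa> * n s + (Ra s * u s + Rb s * v s)) + exp (of_real (t - s) * \<kappa>) * (- \<kappa>) * n s)) (at s within {0..1})"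
      by (intro has_vector_derivative_mult dn s)
    then have "((\<lambda>s. exp (of_real (t - s) * \<kappa>) * n s) has_vector_derivative h' s) (at s within {0..1})"
      by (simp add: h'_def algebra_simps)
    then show "((\<lambda>s. exp (of_real (t - s) * \<kappa>) * n s) has_vector_derivative h' s) (at s within {0..t})"
      by (rule has_vector_derivative_within_subset[OF _ sub])
  qed (use t in auto)
  then have hi: "(h' has_integral (n t - exp (of_real t * \<kappa>) * n 0)) {0..t}" by simp
  have ir: "r integrable_on {0..t}" by (rule integrable_continuous_interval[OF continuous_on_subset[OF cr sub]])
  have "cmod (n t - exp (of_real t * \<kappa>) * n 0) \<le> integral {0..t} (\<lambda>s. exp (\<sigma> * t) * W * r s)"
    unfolding integral_unique[OF hi, symmetric]
  proof (rule integral_norm_bound_integral)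
    show "h' integrable_on {0..t}" using hi by blast
    show "(\<lambda>s. exp (\<sigma> * t) * W * r s) integrable_on {0..t}" 
      by (intro integrable_continuous_interval continuous_intros continuous_on_subset[OF cr sub])
    fix s assume s': "s \<in> {0..t}"
    then have s: "s \<in> {0..1}" using t by auto
    have "cmod (Ra s * u s + Rb s * v s) \<le> r s * cmod (u s) + r s * cmod (v s)"
      using R[OF s] by (intro norm_triangle_mono) (auto simp: norm_mult intro!: mult_right_mono)
    moreover have "cmod (exp (of_real (t - s) * \<kappa>)) \<le> exp (\<sigma> * (t - s))"
      using s' Re\<kappa> mult_left_mono[OF Re\<kappa>, of "t - s"] by (simp add: mult.commute)
    ultimately have "cmod (h' s) \<le> exp (\<sigma> * (t - s)) * (r s * cmod (u s) + r s * cmod (v s))"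
      unfolding h'_def norm_mult by (intro mult_mono) auto
    also have "\<dots> = exp (\<sigma> * t) * r s * (exp (- \<sigma> * s) * (cmod (u s) + cmod (v s)))"
      by (simp add: algebra_simps exp_diff exp_minus divide_inverse)
    also have "\<dots> \<le> exp (\<sigma> * t) * r s * W"
      using W[OF s] r0 by (intro mult_left_mono) auto
    finally show "cmod (h' s) \<le> exp (\<sigma> * t) * W * r s" by (simp add: mult_ac)
  qed
  also have "\<dots> = exp (\<sigma> * t) * W * integral {0..t} r" by simp
  also have "\<dots> \<le> exp (\<sigma> * t) * W * ((c + 2 * L) / cmod l)"
  proof (intro mult_left_mono)
    have "integral {0..t} r \<le> integral {0..1} r"
      by (intro integral_subset_le sub ir integrable_continuous_interval cr) (use r0 in auto)
    also have "\<dots> = (c + integral {0..1} (\<lambda>s. cmod (d1 s)) + integral {0..1} (\<lambda>s. cmod (d3 s))) / cmod l"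
    proof -
      have i: "(\<lambda>s. cmod (d1 s)) integrable_on {0..1}" "(\<lambda>s. cmod (d3 s)) integrable_on {0..1}"
        "(\<lambda>s::real. c) integrable_on {0..1}"
        by (intro integrable_continuous_interval continuous_intros cd)+
      have "((\<lambda>s. (c + cmod (d1 s) + cmod (d3 s)) / cmod l) has_integral 
          ((integral {0..1} (\<lambda>s::real. c) + integral {0..1} (\<lambda>s. cmod (d1 s)) + integral {0..1} (\<lambda>s. cmod (d3 s))) / cmod l)) {0..1}"
        by (intro has_integral_divide has_integral_add integrable_integral i)
      from integral_unique[OF this] show ?thesis unfolding r_def by (simp only: integral_const_real) simp
    qed
    also have "\<dots> \<le> (c + 2 * L) / cmod l" using dL by (intro divide_right_mono) auto
    finally show "integral {0..t} r \<le> (c + 2 * L) / cmod l" .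
  qed (use W0 in auto)
  finally have "cmod (n t - exp (of_real t * \<kappa>) * n 0) \<le> exp (\<sigma> * t) * W * ((c + 2 * L) / cmod l)" .
  then have "exp (- \<sigma> * t) * cmod (n t - exp (of_real t * \<kappa>) * n 0) \<le> 
      exp (- \<sigma> * t) * (exp (\<sigma> * t) * W * ((c + 2 * L) / cmod l))"
    by (intro mult_left_mono) auto
  also have "\<dots> = (exp (- \<sigma> * t) * exp (\<sigma> * t)) * (W * (c + 2 * L) / cmod l)" by simp
  also have "\<dots> = W * (c + 2 * L) / cmod l" by (simp flip: exp_add)
  finally show ?thesis by (simp add: n_def q_def \<kappa>_def c_def mult_ac)
qed

text \<open>Both components of the gauged system are within $O(W/|l|)$ of their free evolution in the weighted
  norm. Undoing the gauge costs another $O((W+1)/|l|)$. At the maximum point of the weighted norm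
  this reads $W \le W/2 + 5/4$ for large $|l|$, so $W$ is bounded by an absolute constant.\<close>

lemma solution_asymptotics:
  fixes l :: complex and m L :: real
  defines "\<sigma> \<equiv> 2 * \<bar>Im (l\<^sup>2)\<bar>"
  defines "D \<equiv> 3 + m + 2 * m\<^sup>2 + m ^ 3 + 2 * L"
  assumes sys: "lax_column_system l f1 f2 f3 f4 u v" and init: "cmod (u 0) + cmod (v 0) \<le> 1"
    and fm: "\<And>t. t \<in> {0..1} \<Longrightarrow> cmod (f1 t) \<le> m" "\<And>t. t \<in> {0..1} \<Longrightarrow> cmod (f2 t) \<le> m"
      "\<And>t. t \<in> {0..1} \<Longrightarrow> cmod (f3 t) \<le> m" "\<And>t. t \<in> {0..1} \<Longrightarrow> cmod (f4 t) \<le> m"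
    and approx: "\<And>f \<delta>. f \<in> {f1, f2, f3, f4} \<Longrightarrow> \<delta> > 0 \<Longrightarrow> \<exists>p d. continuous_on {0..1} d \<and>
      (\<forall>t\<in>{0..1}. (p has_vector_derivative d t) (at t within {0..1})) \<and>
      (\<forall>t\<in>{0..1}. cmod (p t - f t) \<le> \<delta>) \<and> (\<forall>t\<in>{0..1}. cmod (p t) \<le> m) \<and>
      integral {0..1} (\<lambda>t. cmod (d t)) \<le> L"
    and l: "1 \<le> cmod l" "8 * D \<le> cmod l" "8 * m \<le> cmod l" 
    and t: "t \<in> {0..1}"
  shows "exp (- \<sigma> * t) * cmod (u t - exp (- 2 * \<i> * l\<^sup>2 * of_real t) * u 0) \<le> (3 * D + 4 * m) / cmod l"
    and "exp (- \<sigma> * t) * cmod (v t - exp (2 * \<i> * l\<^sup>2 * of_real t) * v 0) \<le> (3 * D + 4 * m) / cmod l"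
proof -
  define \<delta> where "\<delta> = 1 / (cmod l)\<^sup>2"
  have cl: "cmod l > 0" using l(1) by linarith
  then have "\<delta> > 0" by (simp add: \<delta>_def)
  obtain p1 d1 where p1: "continuous_on {0..1} d1"
      "\<And>t. t \<in> {0..1} \<Longrightarrow> (p1 has_vector_derivative d1 t) (at t within {0..1})"
      "\<And>t. t \<in> {0..1} \<Longrightarrow> cmod (p1 t - f1 t) \<le> \<delta>" "\<And>t. t \<in> {0..1} \<Longrightarrow> cmod (p1 t) \<le> m"
      "integral {0..1} (\<lambda>t. cmod (d1 t)) \<le> L" using approx[of f1, OF insertI1 \<open>\<delta> > 0\<close>] by blast
  obtain p2 d2 where p2: "continuous_on {0..1} d2"
      "\<And>t. t \<in> {0..1} \<Longrightarrow> (p2 has_vector_derivative d2 t) (at t within {0..1})"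
      "\<And>t. t \<in> {0..1} \<Longrightarrow> cmod (p2 t - f2 t) \<le> \<delta>" "\<And>t. t \<in> {0..1} \<Longrightarrow> cmod (p2 t) \<le> m"
      "integral {0..1} (\<lambda>t. cmod (d2 t)) \<le> L" using approx[of f2, OF insertI2[OF insertI1] \<open>\<delta> > 0\<close>] by blast
  obtain p3 d3 where p3: "continuous_on {0..1} d3"
      "\<And>t. t \<in> {0..1} \<Longrightarrow> (p3 has_vector_derivative d3 t) (at t within {0..1})"
      "\<And>t. t \<in> {0..1} \<Longrightarrow> cmod (p3 t - f3 t) \<le> \<delta>" "\<And>t. t \<in> {0..1} \<Longrightarrow> cmod (p3 t) \<le> m"
      "integral {0..1} (\<lambda>t. cmod (d3 t)) \<le> L" using approx[of f3, OF insertI2[OF insertI2[OF insertI1]] \<open>\<delta> > 0\<close>] by blast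
  obtain p4 d4 where p4: "continuous_on {0..1} d4"
      "\<And>t. t \<in> {0..1} \<Longrightarrow> (p4 has_vector_derivative d4 t) (at t within {0..1})"
      "\<And>t. t \<in> {0..1} \<Longrightarrow> cmod (p4 t - f4 t) \<le> \<delta>" "\<And>t. t \<in> {0..1} \<Longrightarrow> cmod (p4 t) \<le> m"
      "integral {0..1} (\<lambda>t. cmod (d4 t)) \<le> L" using approx[of f4, OF insertI2[OF insertI2[OF insertI2[OF insertI1]]] \<open>\<delta> > 0\<close>] by blast
  define q where "q = gauge_coeff l p1 p3"
  define k where "k = gauge_coeff (\<i> * l) (\<lambda>t. - \<i> * p2 t) (\<lambda>t. - p4 t)"
  have m0: "m \<ge> 0" using order_trans[OF norm_ge_zero fm(1)[of 0]] by simp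
  have qm: "cmod (q s) \<le> m / cmod l" if "s \<in> {0..1}" for s
    using gauge_coeff_bound[where f=p1 and g=p3 and t=s, OF p1(4)[OF that] p3(4)[OF that] l(1)] by (simp add: q_def)
  have km: "cmod (k s) \<le> m / cmod l" if "s \<in> {0..1}" for s
    using gauge_coeff_bound[of "\<lambda>t. - \<i> * p2 t" s m "\<lambda>t. - p4 t" m "\<i> * l"] p2(4)[OF that] p4(4)[OF that] l(1)
    by (simp add: k_def norm_mult)
  have ml: "m / cmod l \<le> 1 / 8" using l(3) cl by (simp add: field_simps)
  define w where "w = (\<lambda>s. exp (- \<sigma> * s) * (cmod (u s) + cmod (v s)))"
  have cu: "continuous_on {0..1} u" and cv: "continuous_on {0..1} v"
    using sys has_vector_derivative_continuous unfolding lax_column_system_def continuous_on_eq_continuous_within by blast+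
  have "continuous_on {0..1} w" unfolding w_def by (intro continuous_intros cu cv)
  then obtain s0 where s0: "s0 \<in> {0..1}" and s0max: "\<And>s. s \<in> {0..1} \<Longrightarrow> w s \<le> w s0"
    using continuous_attains_sup[of "{0..1::real}" w] by auto
  define W where "W = w s0"
  have W: "exp (- \<sigma> * s) * (cmod (u s) + cmod (v s)) \<le> W" if "s \<in> {0..1}" for s
    using s0max[OF that] by (simp add: w_def W_def)
  have W0: "W \<ge> 0" by (simp add: W_def w_def)
  have estu: "exp (- \<sigma> * s) * cmod (u s + q s * v s - exp (- 2 * \<i> * l\<^sup>2 * of_real s) * (u 0 + q 0 * v 0)) 
         \<le> W * D / cmod l" if s: "s \<in> {0..1}" for s
    unfolding \<sigma>_def D_def q_def
    by (rule gauged_component_estimate[OF sys l(1) fm(1,2,4) p1(2) p3(2) p1(1) p3(1) p1(4) p3(4) 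
          p1(3)[unfolded \<delta>_def] p3(3)[unfolded \<delta>_def] p1(5) p3(5) W[unfolded \<sigma>_def] s])
  have estv: "exp (- \<sigma> * s) * cmod (v s + k s * u s - exp (2 * \<i> * l\<^sup>2 * of_real s) * (v 0 + k 0 * u 0)) 
         \<le> W * D / cmod l" if s: "s \<in> {0..1}" for s
  proof -
    have "exp (- (2 * \<bar>Im ((\<i> * l)\<^sup>2)\<bar>) * s) * cmod (v s + gauge_coeff (\<i> * l) (\<lambda>t. - \<i> * p2 t) (\<lambda>t. - p4 t) s * u s 
           - exp (- 2 * \<i> * (\<i> * l)\<^sup>2 * of_real s) * (v 0 + gauge_coeff (\<i> * l) (\<lambda>t. - \<i> * p2 t) (\<lambda>t. - p4 t) 0 * u 0)) 
         \<le> W * (3 + m + 2 * m\<^sup>2 + m ^ 3 + 2 * L) / cmod (\<i> * l)"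
    proof (rule gauged_component_estimate[OF lax_column_system_swap[OF sys]])
      show "((\<lambda>t. - \<i> * p2 t) has_vector_derivative - \<i> * d2 t) (at t within {0..1})" 
        "((\<lambda>t. - p4 t) has_vector_derivative - d4 t) (at t within {0..1})" if "t \<in> {0..1}" for t
        using p2(2)[OF that] p4(2)[OF that] 
        by (intro has_vector_derivative_mult_right has_vector_derivative_minus; simp)+
      show "continuous_on {0..1} (\<lambda>t. - \<i> * d2 t)" "continuous_on {0..1} (\<lambda>t. - d4 t)"
        by (intro continuous_intros p2 p4)+
      show "cmod (- \<i> * p2 t - - \<i> * f2 t) \<le> 1 / (cmod (\<i> * l))\<^sup>2" if "t \<in> {0..1}" for t
        unfolding right_diff_distrib[symmetric] using p2(3)[OF that] by (simp add: \<delta>_def norm_mult)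
      show "cmod (- p4 t - - f4 t) \<le> 1 / (cmod (\<i> * l))\<^sup>2" if "t \<in> {0..1}" for t
        using p4(3)[OF that] by (simp add: \<delta>_def norm_mult norm_minus_commute)
      show "exp (- (2 * \<bar>Im ((\<i> * l)\<^sup>2)\<bar>) * t) * (cmod (v t) + cmod (u t)) \<le> W" if "t \<in> {0..1}" for t
        using W[OF that] by (simp add: \<sigma>_def power_mult_distrib add.commute)
    qed (use l(1) fm p2 p4 s in \<open>auto simp: norm_mult\<close>)
    then show ?thesis by (simp add: \<sigma>_def D_def k_def norm_mult power_mult_distrib)
  qed
  have exp_bound: "exp (- \<sigma> * s) * cmod (exp (- 2 * \<i> * l\<^sup>2 * of_real s)) \<le> 1"
      "exp (- \<sigma> * s) * cmod (exp (2 * \<i> * l\<^sup>2 * of_real s)) \<le> 1" if "s \<in> {0..1}" for s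
  proof -
    have b: "exp (- \<sigma> * s) * cmod (exp a) \<le> 1" if "Re a \<le> \<sigma> * s" for a
    proof -
      have "exp (- \<sigma> * s) * cmod (exp a) = exp (- \<sigma> * s + Re a)" by (simp only: exp_add norm_exp_eq_Re)
      then show ?thesis using that by simp
    qed
    have "(2 * Im (l\<^sup>2)) * s \<le> \<sigma> * s" "(- 2 * Im (l\<^sup>2)) * s \<le> \<sigma> * s"
      using that by (intro mult_right_mono; simp add: \<sigma>_def)+
    then show "exp (- \<sigma> * s) * cmod (exp (- 2 * \<i> * l\<^sup>2 * of_real s)) \<le> 1"
      "exp (- \<sigma> * s) * cmod (exp (2 * \<i> * l\<^sup>2 * of_real s)) \<le> 1"
      by (intro b; simp)+
  qed
  \<comment> \<open>Undoing the gauge, in a form that serves both components.\<close>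
  have abstract: "e * cmod (x - E * x0) \<le> W * D / cmod l + m / cmod l * W + m / cmod l"
    if "e * cmod (x + g * y - E * (x0 + g0 * y0)) \<le> W * D / cmod l" "cmod g \<le> m / cmod l"
      "cmod g0 \<le> m / cmod l" "e * cmod y \<le> W" "e * cmod E \<le> 1" "cmod y0 \<le> 1" "0 \<le> e" for e x y x0 y0 g g0 E
  proof -
    have eq: "x - E * x0 = (x + g * y - E * (x0 + g0 * y0)) - g * y + E * (g0 * y0)" by (simp add: algebra_simps)
    have "cmod (x - E * x0) \<le> cmod (x + g * y - E * (x0 + g0 * y0)) + cmod (g * y) + cmod (E * (g0 * y0))"
      unfolding eq by (rule order_trans[OF norm_triangle_ineq add_right_mono[OF norm_triangle_ineq4]])
    then have "e * cmod (x - E * x0) \<le> e * (cmod (x + g * y - E * (x0 + g0 * y0)) + cmod (g * y) + cmod (E * (g0 * y0)))"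
      using \<open>0 \<le> e\<close> by (rule mult_left_mono)
    also have "\<dots> = e * cmod (x + g * y - E * (x0 + g0 * y0)) + cmod g * (e * cmod y) + (e * cmod E) * (cmod g0 * cmod y0)"
      by (simp add: norm_mult algebra_simps)
    also have "\<dots> \<le> W * D / cmod l + m / cmod l * W + 1 * (m / cmod l * 1)"
      using that cl m0 W0 by (intro add_mono mult_mono) auto
    finally show ?thesis by simp
  qed
  have eW: "exp (- \<sigma> * s) * cmod (u s) \<le> W" "exp (- \<sigma> * s) * cmod (v s) \<le> W" if "s \<in> {0..1}" for s
    using W[OF that] by (auto simp: distrib_left intro: order_trans[rotated])
  have init1: "cmod (u 0) \<le> 1" "cmod (v 0) \<le> 1" using init norm_ge_zero[of "u 0"] norm_ge_zero[of "v 0"] by linarith+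
  have U: "exp (- \<sigma> * s) * cmod (u s - exp (- 2 * \<i> * l\<^sup>2 * of_real s) * u 0) \<le> W * D / cmod l + m / cmod l * W + m / cmod l"
    if s: "s \<in> {0..1}" for s
    by (rule abstract[OF estu[OF s] qm[OF s] qm eW(2)[OF s] exp_bound(1)[OF s] init1(2)]) auto
  have V: "exp (- \<sigma> * s) * cmod (v s - exp (2 * \<i> * l\<^sup>2 * of_real s) * v 0) \<le> W * D / cmod l + m / cmod l * W + m / cmod l"
    if s: "s \<in> {0..1}" for s
    by (rule abstract[OF estv[OF s] km[OF s] km eW(1)[OF s] exp_bound(2)[OF s] init1(1)]) auto
  have "W \<le> 5 / 2"
  proof -
    have tri: "e * cmod x \<le> e * cmod (x - E * x0) + e * cmod E * cmod x0" if "0 \<le> e" for e and x E x0 :: complex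
      using mult_left_mono[OF norm_triangle_sub[of x "E * x0"] that] by (simp add: norm_mult algebra_simps)
    have "exp (- \<sigma> * s0) * cmod (u s0) \<le> (W * D / cmod l + m / cmod l * W + m / cmod l) + 1 * cmod (u 0)"
      by (rule order_trans[OF tri add_mono[OF U[OF s0] mult_right_mono[OF exp_bound(1)[OF s0]]]]) auto
    moreover have "exp (- \<sigma> * s0) * cmod (v s0) \<le> (W * D / cmod l + m / cmod l * W + m / cmod l) + 1 * cmod (v 0)"
      by (rule order_trans[OF tri add_mono[OF V[OF s0] mult_right_mono[OF exp_bound(2)[OF s0]]]]) auto
    moreover have "W = exp (- \<sigma> * s0) * cmod (u s0) + exp (- \<sigma> * s0) * cmod (v s0)"
      by (simp only: W_def w_def distrib_left)
    moreover have "x + y \<le> 2 * T + 1" if "x \<le> T + 1 * a" "y \<le> T + 1 * b" "a + b \<le> 1" for x y T a b :: real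
      using that by linarith
    ultimately have "W \<le> 2 * (W * D / cmod l + m / cmod l * W + m / cmod l) + 1"
      using init by metis
    moreover have "W * D / cmod l \<le> W / 8" 
      using mult_left_mono[OF l(2) W0] cl by (simp add: field_simps)
    moreover have "m / cmod l * W \<le> 1 / 8 * W" by (rule mult_right_mono[OF ml W0])
    moreover have "X \<le> 5 / 2" if "X \<le> 2 * (x + y + z) + 1" "x \<le> X / 8" "y \<le> 1 / 8 * X" "z \<le> 1 / 8" for X x y z :: real
      using that by auto
    ultimately show ?thesis using ml by metis
  qed
  moreover have D0: "D \<ge> 0"
  proof -
    have "0 \<le> integral {0..1} (\<lambda>t. cmod (d1 t))" by (intro integral_nonneg integrable_continuous_interval continuous_intros p1) auto
    then show ?thesis unfolding D_def using m0 p1(5) by (auto intro!: add_nonneg_nonneg)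
  qed
  ultimately have "W * D / cmod l + m / cmod l * W + m / cmod l \<le> 5 / 2 * D / cmod l + m / cmod l * (5 / 2) + m / cmod l"
    using cl m0 by (intro add_mono divide_right_mono mult_right_mono mult_left_mono) auto
  also have "\<dots> \<le> (3 * D + 4 * m) / cmod l" using D0 m0 cl by (simp add: field_simps)
  finally have fin: "W * D / cmod l + m / cmod l * W + m / cmod l \<le> (3 * D + 4 * m) / cmod l" .
  show "exp (- \<sigma> * t) * cmod (u t - exp (- 2 * \<i> * l\<^sup>2 * of_real t) * u 0) \<le> (3 * D + 4 * m) / cmod l"
    using U[OF t] fin by (rule order_trans)
  show "exp (- \<sigma> * t) * cmod (v t - exp (2 * \<i> * l\<^sup>2 * of_real t) * v 0) \<le> (3 * D + 4 * m) / cmod l"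
    using V[OF t] fin by (rule order_trans)
qed

section \<open>The fundamental matrix\<close>

definition generator :: "(real \<Rightarrow> complex)^4 \<Rightarrow> 2 \<Rightarrow> 2 \<Rightarrow> complex \<Rightarrow> real \<Rightarrow> complex" where
  "generator \<psi> i j l t = (mat (- 2 * \<i> * l\<^sup>2) ** sigma3 + V t l \<psi>) $ i $ j"

lemma generator_simps:
  "generator \<psi> 1 1 l t = - 2 * \<i> * l\<^sup>2 - \<i> * (\<psi> $ 1) t * (\<psi> $ 2) t"
  "generator \<psi> 1 2 l t = 2 * l * (\<psi> $ 1) t + \<i> * (\<psi> $ 3) t"
  "generator \<psi> 2 1 l t = 2 * l * (\<psi> $ 2) t - \<i> * (\<psi> $ 4) t"
  "generator \<psi> 2 2 l t = 2 * \<i> * l\<^sup>2 + \<i> * (\<psi> $ 1) t * (\<psi> $ 2) t"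
  by (simp_all add: generator_def V_def sigma3_def mat_def matrix_matrix_mult_def sum_2)

lemma X1_continuous: "\<psi> \<in> X1 \<Longrightarrow> continuous_on {0..1} (\<psi> $ j)"
  by (simp add: X1_def H1_def)

lemma poly_curve_generator:
  assumes "\<psi> \<in> X1"
  shows "poly_curve (generator \<psi> i j)"
proof -
  note c = X1_continuous[OF assms]
  have quad: "poly_curve (\<lambda>l t. l * (l * a) + b t)" if "continuous_on {0..1} b" for a b
    by (intro poly_curve.add poly_curve.param poly_curve.coeff continuous_intros that)
  have lin: "poly_curve (\<lambda>l t. l * a t + b t)" if "continuous_on {0..1} a" "continuous_on {0..1} b" for a b
    by (intro poly_curve.add poly_curve.param poly_curve.coeff that)
  have "poly_curve (generator \<psi> 1 1)"
    by (rule poly_curve.cong[OF quad[of "\<lambda>t. - \<i> * (\<psi> $ 1) t * (\<psi> $ 2) t" "- 2 * \<i>"]])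
       (auto intro!: continuous_intros c simp: generator_simps power2_eq_square)
  moreover have "poly_curve (generator \<psi> 2 2)"
    by (rule poly_curve.cong[OF quad[of "\<lambda>t. \<i> * (\<psi> $ 1) t * (\<psi> $ 2) t" "2 * \<i>"]])
       (auto intro!: continuous_intros c simp: generator_simps power2_eq_square)
  moreover have "poly_curve (generator \<psi> 1 2)"
    by (rule poly_curve.cong[OF lin[of "\<lambda>t. 2 * (\<psi> $ 1) t" "\<lambda>t. \<i> * (\<psi> $ 3) t"]])
       (auto intro!: continuous_intros c simp: generator_simps)
  moreover have "poly_curve (generator \<psi> 2 1)"
    by (rule poly_curve.cong[OF lin[of "\<lambda>t. 2 * (\<psi> $ 2) t" "\<lambda>t. - \<i> * (\<psi> $ 4) t"]])
       (auto intro!: continuous_intros c simp: generator_simps)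
  ultimately show ?thesis using exhaust_2[of i] exhaust_2[of j] by metis
qed

lemma matrix_has_vector_derivative_iff:
  fixes F :: "real \<Rightarrow> complex^'n^'m"
  shows "(F has_vector_derivative F') (at t within S) \<longleftrightarrow>
    (\<forall>i j. ((\<lambda>t. F t $ i $ j) has_vector_derivative F' $ i $ j) (at t within S))"
proof
  assume F: "(F has_vector_derivative F') (at t within S)"
  have "bounded_linear (\<lambda>A :: complex^'n^'m. A $ i $ j)" for i j
    using bounded_linear_compose[OF bounded_linear_vec_nth bounded_linear_vec_nth] by blast
  from bounded_linear.has_vector_derivative[OF this F]
  show "\<forall>i j. ((\<lambda>t. F t $ i $ j) has_vector_derivative F' $ i $ j) (at t within S)" by blast
next
  assume F: "\<forall>i j. ((\<lambda>t. F t $ i $ j) has_vector_derivative F' $ i $ j) (at t within S)"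
  show "(F has_vector_derivative F') (at t within S)"
    unfolding has_vector_derivative_def has_derivative_componentwise_within[of F]
  proof
    fix b :: "complex^'n^'m" assume "b \<in> Basis"
    then obtain i j z where b: "b = axis i (axis j z)" by (auto simp: Basis_vec_def)
    have "((\<lambda>t. F t $ i $ j \<bullet> z) has_derivative (\<lambda>h. (h *\<^sub>R F' $ i $ j) \<bullet> z)) (at t within S)"
      using F unfolding has_vector_derivative_def by (intro has_derivative_inner_left) auto
    then show "((\<lambda>t. F t \<bullet> b) has_derivative (\<lambda>h. (h *\<^sub>R F') \<bullet> b)) (at t within S)"
      by (simp add: b inner_axis)
  qed
qed

lemma fundamental_solution_columns:
  "is_fundamental_solution l \<psi> F \<longleftrightarrow> (\<forall>i j. F 0 $ i $ j = (if i = j then 1 else 0)) \<and>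
     (\<forall>j. linear_solution (\<lambda>i k. generator \<psi> i k l) (\<lambda>i t. F t $ i $ j))"
proof -
  have "F 0 = mat 1 \<longleftrightarrow> (\<forall>i j. F 0 $ i $ j = (if i = j then 1 else 0))"
    by (simp add: vec_eq_iff mat_def)
  moreover have "(F has_vector_derivative (mat (- 2 * \<i> * l\<^sup>2) ** sigma3 + V t l \<psi>) ** F t) (at t within {0..1}) \<longleftrightarrow>
    (\<forall>i j. ((\<lambda>t. F t $ i $ j) has_vector_derivative (\<Sum>k\<in>UNIV. generator \<psi> i k l t * F t $ k $ j)) (at t within {0..1}))" for t
    unfolding matrix_has_vector_derivative_iff by (simp add: matrix_matrix_mult_def[of _ "F t"] generator_def)
  ultimately show ?thesis unfolding is_fundamental_solution_def linear_solution_def by blast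
qed

text \<open>Uniqueness on $[0,1]$ identifies the chosen solution with the one depending holomorphically on the
  parameter, although the choice is made separately for every $\lambda$.\<close>

lemma fundamental_solution_entries:
  assumes "\<psi> \<in> X1"
  shows "\<And>t i j. t \<in> {0..1} \<Longrightarrow> (\<lambda>l. M t l \<psi> $ i $ j) holomorphic_on UNIV"
    and "\<And>j. linear_solution (\<lambda>i k. generator \<psi> i k l) (\<lambda>i t. M t l \<psi> $ i $ j)"
    and "M 0 l \<psi> = mat 1"
proof -
  have "\<forall>j. \<exists>x. (\<forall>l. linear_solution (\<lambda>i k. generator \<psi> i k l) (\<lambda>i. x i l)) \<and> 
      (\<forall>l i. x i l 0 = (if i = j then 1 else 0)) \<and> (\<forall>t\<in>{0..1}. \<forall>i. (\<lambda>l. x i l t) holomorphic_on UNIV)"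
    by (intro allI linear_solution_exists_holomorphic[where A="generator \<psi>"] poly_curve_generator[OF assms])
  then obtain x where x: "\<And>j l. linear_solution (\<lambda>i k. generator \<psi> i k l) (\<lambda>i. x j i l)"
      "\<And>j l i. x j i l 0 = (if i = j then 1 else 0)" 
      "\<And>j t i. t \<in> {0..1} \<Longrightarrow> (\<lambda>l. x j i l t) holomorphic_on UNIV" by metis
  have "is_fundamental_solution l \<psi> (\<lambda>t. \<chi> i j. x j i l t)" for l
    unfolding fundamental_solution_columns using x by simp
  then have ex: "\<exists>F. is_fundamental_solution l \<psi> F" for l by blast
  have "is_fundamental_solution l \<psi> (\<lambda>t. M t l \<psi>)" for l
    unfolding M_def using someI_ex[OF ex] by simp
  then have init: "\<And>l i j. M 0 l \<psi> $ i $ j = (if i = j then 1 else 0)"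
    and sol: "\<And>l j. linear_solution (\<lambda>i k. generator \<psi> i k l) (\<lambda>i t. M t l \<psi> $ i $ j)"
    unfolding fundamental_solution_columns by blast+
  show "\<And>j. linear_solution (\<lambda>i k. generator \<psi> i k l) (\<lambda>i t. M t l \<psi> $ i $ j)" by (rule sol)
  show "M 0 l \<psi> = mat 1" by (simp add: vec_eq_iff init mat_def)
  fix t :: real and i j assume t: "t \<in> {0..1}"
  have "M t l \<psi> $ i $ j = x j i l t" for l
    by (rule linear_solution_unique[OF _ sol x(1) _ t])
       (simp_all add: init x poly_curve_continuous[OF poly_curve_generator[OF assms]])
  then show "(\<lambda>l. M t l \<psi> $ i $ j) holomorphic_on UNIV" using x(3)[OF t] by simp
qed

section \<open>Uniform bounds on bounded sets\<close>

lemma X1_norm_component: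
  assumes "X1_norm \<psi> \<le> R"
  shows "(LINT t:{0..1}|lborel. (cmod ((\<psi> $ j) t))\<^sup>2 + (cmod (weak_deriv (\<psi> $ j) t))\<^sup>2) \<le> R\<^sup>2"
proof -
  let ?I = "\<lambda>j. LINT t:{0..1}|lborel. (cmod ((\<psi> $ j) t))\<^sup>2 + (cmod (weak_deriv (\<psi> $ j) t))\<^sup>2"
  have pos: "0 \<le> ?I j" for j unfolding set_lebesgue_integral_def by (intro Bochner_Integration.integral_nonneg) auto
  have "?I j \<le> (\<Sum>j\<in>UNIV. ?I j)" by (intro member_le_sum[where f="?I"] pos) auto
  also have "\<dots> \<le> R\<^sup>2" using assms unfolding X1_norm_def by (rule sqrt_le_D)
  finally show ?thesis .
qed

text \<open>Each entry is a component of the column with initial value a unit vector, to which the scalar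
  asymptotics apply with constants depending only on the norm bound $R$.\<close>

lemma entry_asymptotics:
  assumes \<psi>: "\<psi> \<in> X1" and R: "X1_norm \<psi> \<le> R"
  defines "m \<equiv> 2 + 2 * R\<^sup>2"
  defines "D \<equiv> 3 + m + 2 * m\<^sup>2 + m ^ 3 + 2 * (1 + R\<^sup>2)"
  assumes l: "8 * D \<le> cmod l" and t: "t \<in> {0..1}"
  shows "exp (- (2 * \<bar>Im (l\<^sup>2)\<bar>) * t) * cmod (M t l \<psi> $ i $ j - E l t $ i $ j) \<le> (3 * D + 4 * m) / cmod l"
proof -
  let ?u = "\<lambda>t. M t l \<psi> $ 1 $ j" and ?v = "\<lambda>t. M t l \<psi> $ 2 $ j"
  have H: "\<psi> $ k \<in> H1" for k using \<psi> by (simp add: X1_def)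
  note b = H1_bounds[OF H X1_norm_component[OF R]]
  have sys: "lax_column_system l (\<psi> $ 1) (\<psi> $ 2) (\<psi> $ 3) (\<psi> $ 4) ?u ?v"
    using fundamental_solution_entries(2)[OF \<psi>, of l j]
    unfolding linear_solution_def lax_column_system_def by (simp add: sum_2 generator_simps forall_2)
  have approx: "\<exists>p d. continuous_on {0..1} d \<and>
      (\<forall>t\<in>{0..1}. (p has_vector_derivative d t) (at t within {0..1})) \<and>
      (\<forall>t\<in>{0..1}. cmod (p t - f t) \<le> \<delta>) \<and> (\<forall>t\<in>{0..1}. cmod (p t) \<le> m) \<and>
      integral {0..1} (\<lambda>t. cmod (d t)) \<le> 1 + R\<^sup>2" 
    if f: "f \<in> {\<psi> $ 1, \<psi> $ 2, \<psi> $ 3, \<psi> $ 4}" and \<delta>: "\<delta> > 0" for f \<delta>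
  proof -
    obtain k where k: "f = \<psi> $ k" using f by blast
    obtain v where v: "variation_majorant f v" "v 1 \<le> 1 + R\<^sup>2" using b(1)[of k] k by blast
    have "cmod (f s) \<le> m" if "s \<in> {0..1}" for s using b(2)[of k] that by (simp add: k m_def)
    from smooth_approximation[OF _ v(1) this \<delta>] show ?thesis
      using v(2) X1_continuous[OF \<psi>] unfolding k by (meson order_trans)
  qed
  have "m \<ge> 2" by (simp add: m_def)
  then have "D \<ge> m" "D \<ge> 1" unfolding D_def by (auto intro!: add_nonneg_nonneg)
  then have l': "1 \<le> cmod l" "8 * m \<le> cmod l" using l by linarith+
  have init: "cmod (?u 0) + cmod (?v 0) \<le> 1"
    using exhaust_2[of j] by (auto simp: fundamental_solution_entries(3)[OF \<psi>] mat_def)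
  have bm: "cmod ((\<psi> $ k) s) \<le> m" if "s \<in> {0..1}" for k s using b(2)[of k] that by (simp add: m_def)
  note est0 = solution_asymptotics[OF sys]
  note est = est0[OF init bm bm bm bm approx l'(1) l[unfolded D_def] l'(2) t]
  have "E l t $ 1 $ j = exp (- 2 * \<i> * l\<^sup>2 * of_real t) * ?u 0" "E l t $ 2 $ j = exp (2 * \<i> * l\<^sup>2 * of_real t) * ?v 0"
    using exhaust_2[of j] by (auto simp: fundamental_solution_entries(3)[OF \<psi>] mat_def E_def)
  then show ?thesis using est exhaust_2[of i] unfolding D_def by auto
qed

lemma op_norm_le_sum_entries: "op_norm A \<le> (\<Sum>i\<in>UNIV. \<Sum>j\<in>UNIV. cmod (A $ i $ j))"
  unfolding op_norm_def
proof (rule onorm_le)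
  fix x :: "complex^2"
  have "norm (A *v x) \<le> (\<Sum>i\<in>UNIV. cmod ((A *v x) $ i))"
    unfolding norm_vec_def by (intro L2_set_le_sum) auto
  also have "\<dots> \<le> (\<Sum>i\<in>UNIV. \<Sum>j\<in>UNIV. cmod (A $ i $ j) * norm x)"
    unfolding matrix_vector_mult_def
    by (auto intro!: sum_mono sum_norm_le simp: norm_mult mult_left_mono Finite_Cartesian_Product.norm_nth_le)
  finally show "norm (A *v x) \<le> (\<Sum>i\<in>UNIV. \<Sum>j\<in>UNIV. cmod (A $ i $ j)) * norm x"
    by (simp add: sum_distrib_right)
qed

lemma op_norm_le_of_entries:
  assumes "\<And>i j. cmod (A $ i $ j) \<le> b"
  shows "op_norm A \<le> 4 * b"
  using op_norm_le_sum_entries[of A] assms[of 1 1] assms[of 1 2] assms[of 2 1] assms[of 2 2]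
  by (simp add: sum_2)

lemma E_entry_holomorphic: "(\<lambda>l. E l t $ i $ j) holomorphic_on UNIV"
  using exhaust_2[of i] exhaust_2[of j] by (auto simp: E_def intro!: holomorphic_intros)

text \<open>On the circle $|z-\lambda| = 1/|\lambda|$ one has $|z^2-\lambda^2| \le (2|\lambda|+1)/|\lambda| \le 3$, which accounts for
  the factor $e^6$; there $|z| \ge |\lambda|/2$, which accounts for the factor $2$.\<close>

lemma derivative_entry_asymptotics:
  assumes \<psi>: "\<psi> \<in> X1" and t: "t \<in> {0..1}" and C: "0 \<le> C" and K: "0 \<le> K"
    and bound: "\<And>z. K < cmod z \<Longrightarrow> 
      exp (- (2 * \<bar>Im (z\<^sup>2)\<bar>) * t) * cmod (M t z \<psi> $ i $ j - E z t $ i $ j) \<le> C / cmod z"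
    and l: "K + 2 < cmod l"
  shows "cmod (matrix_deriv (\<lambda>z. M t z \<psi>) l $ i $ j - matrix_deriv (\<lambda>z. E z t) l $ i $ j)
         \<le> 2 * C * exp 6 * exp (2 * \<bar>Im (l\<^sup>2)\<bar> * t)"
proof -
  define f where "f = (\<lambda>z. M t z \<psi> $ i $ j - E z t $ i $ j)"
  note hM = fundamental_solution_entries(1)[OF \<psi> t, of i j] and hE = E_entry_holomorphic[of t i j]
  have hf: "f holomorphic_on UNIV" unfolding f_def by (intro holomorphic_intros hM hE)
  have l2: "2 < cmod l" using l K by linarith
  define r where "r = 1 / cmod l"
  have r: "0 < r" "r \<le> 1" "r * cmod l = 1" using l2 by (auto simp: r_def divide_le_eq)
  have fz: "cmod (f z) \<le> 2 * C / cmod l * (exp 6 * exp (2 * \<bar>Im (l\<^sup>2)\<bar> * t))" if z: "norm (l - z) = r" for z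
  proof -
    have z1: "cmod l - r \<le> cmod z" "cmod z \<le> cmod l + r"
      using z norm_triangle_ineq2[of l z] norm_triangle_ineq3[of l z] by auto
    have "cmod z > K" using z1 r l by linarith
    from bound[OF this] have "cmod (f z) \<le> C / cmod z * exp (2 * \<bar>Im (z\<^sup>2)\<bar> * t)"
      by (simp add: f_def exp_minus field_simps)
    also have "\<dots> \<le> 2 * C / cmod l * exp (6 + 2 * \<bar>Im (l\<^sup>2)\<bar> * t)"
    proof (rule mult_mono)
      have "cmod l / 2 \<le> cmod z" using z1 r l2 by linarith
      then have "C / cmod z \<le> C / (cmod l / 2)" using C l2 by (intro divide_left_mono mult_pos_pos) auto
      then show "C / cmod z \<le> 2 * C / cmod l" by (simp add: mult.commute)
      have "l\<^sup>2 - z\<^sup>2 = (l - z) * (l + z)" by (simp add: power2_eq_square algebra_simps)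
      then have "cmod (l\<^sup>2 - z\<^sup>2) = r * cmod (l + z)" by (simp add: norm_mult z)
      also have "\<dots> \<le> r * (2 * cmod l + 1)"
        using z1 r norm_triangle_ineq[of l z] by (intro mult_left_mono) auto
      also have "\<dots> \<le> 3" using r by (simp add: distrib_left)
      finally have "\<bar>Im (l\<^sup>2) - Im (z\<^sup>2)\<bar> \<le> 3" using abs_Im_le_cmod[of "l\<^sup>2 - z\<^sup>2"] by simp
      then have "2 * \<bar>Im (z\<^sup>2)\<bar> * t \<le> (6 + 2 * \<bar>Im (l\<^sup>2)\<bar>) * t"
        using t by (intro mult_right_mono) auto
      also have "\<dots> \<le> 6 + 2 * \<bar>Im (l\<^sup>2)\<bar> * t" using t by (simp add: distrib_right)
      finally show "exp (2 * \<bar>Im (z\<^sup>2)\<bar> * t) \<le> exp (6 + 2 * \<bar>Im (l\<^sup>2)\<bar> * t)" by simp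
    qed (use C in auto)
    finally show ?thesis by (simp add: exp_add)
  qed
  have "norm ((deriv ^^ 1) f l) \<le> fact 1 * (2 * C / cmod l * (exp 6 * exp (2 * \<bar>Im (l\<^sup>2)\<bar> * t))) / r ^ 1"
    using hf by (intro Cauchy_inequality fz r)
      (auto intro: holomorphic_on_subset continuous_on_subset[OF holomorphic_on_imp_continuous_on])
  moreover have "deriv f l = matrix_deriv (\<lambda>z. M t z \<psi>) l $ i $ j - matrix_deriv (\<lambda>z. E z t) l $ i $ j"
    unfolding f_def matrix_deriv_def vec_lambda_beta
    by (intro deriv_diff holomorphic_on_imp_differentiable_at[OF hM] holomorphic_on_imp_differentiable_at[OF hE]) auto
  moreover have "fact 1 * (2 * C / cmod l * (exp 6 * exp (2 * \<bar>Im (l\<^sup>2)\<bar> * t))) / r ^ 1 = 2 * C * exp 6 * exp (2 * \<bar>Im (l\<^sup>2)\<bar> * t)"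
    using l2 by (auto simp: r_def)
  ultimately show ?thesis by simp
qed

theorem theorem2p7:
  fixes B :: "((real \<Rightarrow> complex)^4) set"
  assumes "X1_bounded B"
  shows "(\<exists>C>0. \<exists>K>0. \<forall>t\<in>{0..1}. \<forall>l::complex. cmod l > K \<longrightarrow> (\<forall>\<psi>\<in>B.
            cmod l * exp (- 2 * \<bar>Im (l\<^sup>2)\<bar> * t) * op_norm (M t l \<psi> - E l t) \<le> C))
       \<and> (\<exists>C'>0. \<exists>K'>0. \<forall>t\<in>{0..1}. \<forall>l::complex. cmod l > K' \<longrightarrow> (\<forall>\<psi>\<in>B.
            op_norm (matrix_deriv (\<lambda>z. M t z \<psi>) l - matrix_deriv (\<lambda>z. E z t) l)
              \<le> C' * exp (2 * \<bar>Im (l\<^sup>2)\<bar> * t)))"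
proof -
  obtain R where BX: "B \<subseteq> X1" and R: "\<And>\<psi>. \<psi> \<in> B \<Longrightarrow> X1_norm \<psi> \<le> R"
    using assms unfolding X1_bounded_def by blast
  define m where "m = 2 + 2 * R\<^sup>2"
  define D where "D = 3 + m + 2 * m\<^sup>2 + m ^ 3 + 2 * (1 + R\<^sup>2)"
  define C where "C = 3 * D + 4 * m"
  have "m > 0" unfolding m_def by (simp add: add_pos_nonneg)
  then have "D > 0" unfolding D_def by (intro add_pos_nonneg) auto
  have C0: "C > 0" unfolding C_def using \<open>m > 0\<close> \<open>D > 0\<close> by simp
  have entry: "exp (- (2 * \<bar>Im (l\<^sup>2)\<bar>) * t) * cmod (M t l \<psi> $ i $ j - E l t $ i $ j) \<le> C / cmod l"
    if "8 * D < cmod l" "t \<in> {0..1}" "\<psi> \<in> B" for l t \<psi> i j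
    using entry_asymptotics[of \<psi> R l t i j] that BX R unfolding C_def D_def m_def by auto
  have "cmod l * exp (- 2 * \<bar>Im (l\<^sup>2)\<bar> * t) * op_norm (M t l \<psi> - E l t) \<le> 4 * C"
    if *: "t \<in> {0..1}" "8 * D < cmod l" "\<psi> \<in> B" for t l \<psi>
  proof -
    have l0: "cmod l > 0" using *(2) \<open>D > 0\<close> by linarith
    define e where "e = exp (- 2 * \<bar>Im (l\<^sup>2)\<bar> * t)"
    have e: "e > 0" by (simp add: e_def)
    have "cmod ((M t l \<psi> - E l t) $ i $ j) \<le> C / (cmod l * e)" for i j
    proof -
      have "e * cmod (M t l \<psi> $ i $ j - E l t $ i $ j) \<le> C / cmod l"
        using entry[OF *(2,1,3), of i j] by (simp add: e_def)
      then show ?thesis using e l0 by (simp add: field_simps)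
    qed
    from op_norm_le_of_entries[OF this]
    have "(cmod l * e) * op_norm (M t l \<psi> - E l t) \<le> (cmod l * e) * (4 * (C / (cmod l * e)))"
      using l0 e by (intro mult_left_mono) auto
    also have "\<dots> = 4 * C" using l0 e by simp
    finally show ?thesis unfolding e_def .
  qed
  moreover have "op_norm (matrix_deriv (\<lambda>z. M t z \<psi>) l - matrix_deriv (\<lambda>z. E z t) l) 
      \<le> 8 * C * exp 6 * exp (2 * \<bar>Im (l\<^sup>2)\<bar> * t)"
    if *: "t \<in> {0..1}" "8 * D + 2 < cmod l" "\<psi> \<in> B" for t l \<psi>
  proof -
    have "cmod ((matrix_deriv (\<lambda>z. M t z \<psi>) l - matrix_deriv (\<lambda>z. E z t) l) $ i $ j)
            \<le> 2 * C * exp 6 * exp (2 * \<bar>Im (l\<^sup>2)\<bar> * t)" for i j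
      unfolding vector_minus_component
      by (rule derivative_entry_asymptotics[OF _ *(1) _ _ entry *(2)]) (use * BX C0 \<open>D > 0\<close> in auto)
    from op_norm_le_of_entries[OF this] show ?thesis by simp
  qed
  moreover have "0 < 4 * C" "0 < 8 * D" "0 < 8 * C * exp 6" "0 < 8 * D + 2"
    using C0 \<open>D > 0\<close> by simp_all
  ultimately show ?thesis by blast
qed

end
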